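(* Let $F$ be a field, let $K$ be a Galois $C_n$-algebra over $F$ of dimension $n$ with $G={\rm Aut}_F(K)=\langle \sigma\rangle$, where $\sigma$ has order $n$, and let $(K/F,\sigma,d)$ be a proper nonassociative cyclic algebra, i.e. $d\in K\setminus F$. Let $H=\{\tau\in G\mid \tau(d)=d\}$. Then $H=\langle\sigma^s\rangle$ for some positive integer $s$ such that $n=sr$. Put $E={\rm Fix}(\sigma^s)=\{x\in K\mid\sigma^s(x)=x\}$. Then the following hold. (i) ${\rm Nuc}_r((K/F,\sigma,d))=K[t;\sigma^s]/K[t;\sigma^s](t^r-d)$ is a Petit algebra with center $E$. In particular, $K\subset {\rm Nuc}_r((K/F,\sigma,d))$ and hence $K\subset {\rm Nuc}((K/F,\sigma,d))$. Moreover, if $n$ is prime then ${\rm Nuc}_r((K/F,\sigma,d))=K$. (ii) If $K/F$ is a Galois field extension, then ${\rm Nuc}_r((K/F,\sigma,d))=(K/E,\sigma^s,d)$ is a cyclic algebra of degree $r$ over the field $E$, where $[E:F]=s$. Moreover, ${\rm Nuc}((K/F,\sigma,d))=K$.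
   Context: Algebras are unital and not necessarily associative. For an algebra $A$ put $[x,y,z]=(xy)z-x(yz)$; ${\rm Nuc}_l(A)=\{x\mid[x,A,A]=0\}$, ${\rm Nuc}_m(A)=\{x\mid[A,x,A]=0\}$, ${\rm Nuc}_r(A)=\{x\mid[A,A,x]=0\}$, and ${\rm Nuc}(A)$ is the intersection of these three. A Galois $C_n$-algebra over $F$ is an $n$-dimensional étale $F$-algebra $K$ (a finite product of finite separable field extensions of $F$) with an action of a cyclic group $C_n$ of $F$-automorphisms whose fixed ring is $F$. Petit algebras: for an automorphism $\rho$ of a unital associative ring $S$, $S[t;\rho]$ is the skew polynomial ring with $ta=\rho(a)t$. For a monic $f\in S[t;\rho]$ of degree $m$, $S[t;\rho]/S[t;\rho]f$ denotes the (Petit) algebra whose underlying additive group is $\{g\mid\deg g<m\}$, with multiplication $g\circ h=gh\ {\rm mod}_r f$, the remainder of $gh$ after right division by $f$ (i.e. $gh=qf+{\rm rem}$ with $\deg{\rm rem}<m$). The nonassociative cyclic algebra $(K/F,\sigma,d)$, $d\in K^\times$, is the $F$-central algebra $K[t;\sigma]/K[t;\sigma](t^n-d)$; it is called proper if it is not associative. The same notation $(K/E,\sigma^s,d)$ is used for the associative cyclic algebra $K[t;\sigma^s]/K[t;\sigma^s](t^r-d)$ over $E$. In the equalities for the right nucleus, the variable $t$ of $K[t;\sigma^s]$ is identified with the element $t^s$ of $(K/F,\sigma,d)$. *)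

theory Defs
  imports "HOL-Algebra.Algebra" "HOL-Computational_Algebra.Primes"
begin

section \<open>Nuclei and centre of a not necessarily associative algebra\<close>

text \<open>A nonassociative algebra is a ring record on which the ring axioms are not imposed.\<close>

definition associator :: "('a, 'm) ring_scheme \<Rightarrow> 'a \<Rightarrow> 'a \<Rightarrow> 'a \<Rightarrow> 'a" where
  "associator A x y z = ((x \<otimes>\<^bsub>A\<^esub> y) \<otimes>\<^bsub>A\<^esub> z) \<ominus>\<^bsub>A\<^esub> (x \<otimes>\<^bsub>A\<^esub> (y \<otimes>\<^bsub>A\<^esub> z))"

definition nuc_l :: "('a, 'm) ring_scheme \<Rightarrow> 'a set" where
  "nuc_l A = {x \<in> carrier A. \<forall>y\<in>carrier A. \<forall>z\<in>carrier A. associator A x y z = \<zero>\<^bsub>A\<^esub>}"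

definition nuc_m :: "('a, 'm) ring_scheme \<Rightarrow> 'a set" where
  "nuc_m A = {x \<in> carrier A. \<forall>y\<in>carrier A. \<forall>z\<in>carrier A. associator A y x z = \<zero>\<^bsub>A\<^esub>}"

definition nuc_r :: "('a, 'm) ring_scheme \<Rightarrow> 'a set" where
  "nuc_r A = {x \<in> carrier A. \<forall>y\<in>carrier A. \<forall>z\<in>carrier A. associator A y z x = \<zero>\<^bsub>A\<^esub>}"

definition nuc :: "('a, 'm) ring_scheme \<Rightarrow> 'a set" where
  "nuc A = nuc_l A \<inter> nuc_m A \<inter> nuc_r A"

definition alg_center :: "('a, 'm) ring_scheme \<Rightarrow> 'a set" where
  "alg_center A = {x \<in> nuc A. \<forall>y\<in>carrier A. x \<otimes>\<^bsub>A\<^esub> y = y \<otimes>\<^bsub>A\<^esub> x}"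

definition associative_alg :: "('a, 'm) ring_scheme \<Rightarrow> bool" where
  "associative_alg A \<longleftrightarrow>
     (\<forall>x\<in>carrier A. \<forall>y\<in>carrier A. \<forall>z\<in>carrier A. associator A x y z = \<zero>\<^bsub>A\<^esub>)"


section \<open>Etale algebras, automorphism groups and Galois algebras\<close>

text \<open>
  Polynomials in \<open>K[X]\<close> are coefficient lists with the leading coefficient first. Normalization
  is needed because leading coefficients may vanish in positive characteristic.
\<close>

definition formal_deriv :: "('a, 'm) ring_scheme \<Rightarrow> 'a list \<Rightarrow> 'a list" where
  "formal_deriv L p =
     ring.normalize L (map (\<lambda>i. add_pow L (length p - 1 - i) (p ! i)) [0..<length p - 1])"

definition separable_element :: "('a, 'm) ring_scheme \<Rightarrow> 'a set \<Rightarrow> 'a \<Rightarrow> bool" where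
  "separable_element L F x \<longleftrightarrow>
     (ring.algebraic L over F) x \<and>
     (let P = univ_poly L F; p = ring.Irr L F x in
        \<exists>u\<in>carrier P. \<exists>v\<in>carrier P. (u \<otimes>\<^bsub>P\<^esub> p) \<oplus>\<^bsub>P\<^esub> (v \<otimes>\<^bsub>P\<^esub> formal_deriv L p) = \<one>\<^bsub>P\<^esub>)"

definition finite_separable_extension :: "('a, 'm) ring_scheme \<Rightarrow> 'a set \<Rightarrow> bool" where
  "finite_separable_extension L F \<longleftrightarrow>
     field L \<and> subfield F L \<and> ring.finite_dimension L F (carrier L) \<and>
     (\<forall>x\<in>carrier L. separable_element L F x)"

text \<open>
  The base field \<open>F\<close> is a subfield of the ring \<open>K\<close>; it acts on the \<open>i\<close>-th factor through its image
  there. Taking the factors over the element type of \<open>K\<close> is no restriction: the \<open>i\<close>-th factor is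
  isomorphic to \<open>K e\<^sub>i\<close>, where \<open>e\<^sub>i\<close> is the corresponding idempotent.
\<close>

definition etale_algebra :: "'a set \<Rightarrow> ('a, 'm) ring_scheme \<Rightarrow> bool" where
  "etale_algebra F K \<longleftrightarrow> cring K \<and> subfield F K \<and>
     (\<exists>(Ls :: 'a ring list) \<phi>. \<phi> \<in> ring_iso K (RDirProd_list Ls) \<and>
        (\<forall>i<length Ls. finite_separable_extension (Ls ! i) ((\<lambda>x. \<phi> x ! i) ` F)))"

text \<open>As in \<^const>\<open>AutoGroup\<close>, automorphisms are extensional outside the carrier.\<close>

definition aut_group :: "'a set \<Rightarrow> ('a, 'm) ring_scheme \<Rightarrow> ('a \<Rightarrow> 'a) monoid" where
  "aut_group F K = BijGroup (carrier K)
     \<lparr>carrier := {\<tau> \<in> ring_hom K K \<inter> Bij (carrier K). \<forall>x\<in>F. \<tau> x = x}\<rparr>"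

definition galois_cyclic_algebra ::
    "'a set \<Rightarrow> ('a, 'm) ring_scheme \<Rightarrow> nat \<Rightarrow> ('a \<Rightarrow> 'a) \<Rightarrow> bool" where
  "galois_cyclic_algebra F K n \<sigma> \<longleftrightarrow>
     etale_algebra F K \<and> ring.dimension K n F (carrier K) \<and>
     \<sigma> \<in> carrier (aut_group F K) \<and> group.ord (aut_group F K) \<sigma> = n \<and>
     {x \<in> carrier K. \<forall>\<tau>\<in>generate (aut_group F K) {\<sigma>}. \<tau> x = x} = F"

definition galois_field_extension :: "'a set \<Rightarrow> ('a, 'm) ring_scheme \<Rightarrow> bool" where
  "galois_field_extension F K \<longleftrightarrow>
     field K \<and> subfield F K \<and> ring.finite_dimension K F (carrier K) \<and>
     {x \<in> carrier K. \<forall>\<tau>\<in>carrier (aut_group F K). \<tau> x = x} = F"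


section \<open>Petit algebras\<close>

text \<open>Skew polynomials \<open>\<Sum> a\<^sub>i t\<^sup>i\<close> with \<open>t a = \<rho>(a) t\<close>, on the additive group of \<^const>\<open>UP\<close>.\<close>

definition skew_UP :: "('a, 'm) ring_scheme \<Rightarrow> ('a \<Rightarrow> 'a) \<Rightarrow> ('a, nat \<Rightarrow> 'a) up_ring" where
  "skew_UP S \<rho> = (UP S)
     \<lparr>mult := (\<lambda>p\<in>up S. \<lambda>q\<in>up S. \<lambda>k. \<Oplus>\<^bsub>S\<^esub>i\<in>{..k}. p i \<otimes>\<^bsub>S\<^esub> (\<rho> ^^ i) (q (k - i)))\<rparr>"

text \<open>
  Polynomials of degree less than \<open>m\<close>; the zero polynomial is always one of them, whereas
  \<^const>\<open>deg\<close> assigns it the degree \<open>0\<close>.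
\<close>

definition polys_below :: "('a, 'm) ring_scheme \<Rightarrow> nat \<Rightarrow> (nat \<Rightarrow> 'a) set" where
  "polys_below S m = {g \<in> up S. \<forall>i\<ge>m. coeff (UP S) g i = \<zero>\<^bsub>S\<^esub>}"

definition right_rem ::
    "('a, 'm) ring_scheme \<Rightarrow> ('a \<Rightarrow> 'a) \<Rightarrow> (nat \<Rightarrow> 'a) \<Rightarrow> (nat \<Rightarrow> 'a) \<Rightarrow> (nat \<Rightarrow> 'a)" where
  "right_rem S \<rho> f u =
     (THE r. r \<in> polys_below S (deg S f) \<and>
        (\<exists>q\<in>up S. u = (q \<otimes>\<^bsub>skew_UP S \<rho>\<^esub> f) \<oplus>\<^bsub>skew_UP S \<rho>\<^esub> r))"

definition petit ::
    "('a, 'm) ring_scheme \<Rightarrow> ('a \<Rightarrow> 'a) \<Rightarrow> (nat \<Rightarrow> 'a) \<Rightarrow> ('a, nat \<Rightarrow> 'a) up_ring" where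
  "petit S \<rho> f = (skew_UP S \<rho>)
     \<lparr>carrier := polys_below S (deg S f),
      mult := (\<lambda>g h. right_rem S \<rho> f (g \<otimes>\<^bsub>skew_UP S \<rho>\<^esub> h))\<rparr>"

definition const_poly :: "('a, 'm) ring_scheme \<Rightarrow> 'a \<Rightarrow> (nat \<Rightarrow> 'a)" where
  "const_poly S a = monom (UP S) a 0"

text \<open>\<open>K[t;\<sigma>]/K[t;\<sigma>](t\<^sup>n - d)\<close>\<close>

definition cyclic_alg ::
    "('a, 'm) ring_scheme \<Rightarrow> ('a \<Rightarrow> 'a) \<Rightarrow> nat \<Rightarrow> 'a \<Rightarrow> ('a, nat \<Rightarrow> 'a) up_ring" where
  "cyclic_alg K \<sigma> n d =
     petit K \<sigma> (monom (UP K) \<one>\<^bsub>K\<^esub> n \<ominus>\<^bsub>UP K\<^esub> const_poly K d)"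

text \<open>The substitution \<open>g(t) \<mapsto> g(t\<^sup>s)\<close>\<close>

definition subst_pow :: "('a, 'm) ring_scheme \<Rightarrow> nat \<Rightarrow> (nat \<Rightarrow> 'a) \<Rightarrow> (nat \<Rightarrow> 'a)" where
  "subst_pow K s g = (\<lambda>i. if s dvd i then g (i div s) else \<zero>\<^bsub>K\<^esub>)"

text \<open>
  The data \<open>(K/E, \<tau>, d)\<close> define an associative cyclic algebra of degree \<open>r\<close> over the field \<open>E\<close>:
  \<open>K/E\<close> is a Galois field extension of degree \<open>r\<close> with group generated by \<open>\<tau>\<close>, \<open>d\<close> is a nonzero
  element of \<open>E\<close>, and the resulting algebra is an associative ring of dimension \<open>r\<^sup>2\<close> over \<open>E\<close>.
\<close>

definition assoc_cyclic_algebra ::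
    "'a set \<Rightarrow> ('a, 'm) ring_scheme \<Rightarrow> ('a \<Rightarrow> 'a) \<Rightarrow> nat \<Rightarrow> 'a \<Rightarrow> bool" where
  "assoc_cyclic_algebra E K \<tau> r d \<longleftrightarrow>
     galois_field_extension E K \<and> ring.dimension K r E (carrier K) \<and>
     \<tau> \<in> carrier (aut_group E K) \<and> generate (aut_group E K) {\<tau>} = carrier (aut_group E K) \<and>
     d \<in> E - {\<zero>\<^bsub>K\<^esub>} \<and>
     ring (cyclic_alg K \<tau> r d) \<and>
     ring.dimension (cyclic_alg K \<tau> r d) (r\<^sup>2) (const_poly K ` E) (carrier (cyclic_alg K \<tau> r d))"

end

theory Submission
  imports Defs
begin

text \<open>
  Write \<open>A = (K/F, \<sigma>, d)\<close>. Modulo \<open>t\<^sup>n - d\<close> the product of two monomials is again a monomial: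
  \<open>x t\<^sup>a\<close> times \<open>y t\<^sup>b\<close> is \<open>x \<sigma>\<^sup>a(y) t\<^sup>a\<^sup>+\<^sup>b\<close> if \<open>a + b < n\<close>, and otherwise the power of \<open>t\<close> is lowered
  by \<open>n\<close> at the cost of the factor \<open>\<sigma>\<^sup>a\<^sup>+\<^sup>b\<^sup>-\<^sup>n(d)\<close> (lemma \<open>mult_alg\<close>). Comparing the two bracketings of
  a product of monomials \<open>x t\<^sup>a\<close>, \<open>y t\<^sup>b\<close>, \<open>z t\<^sup>c\<close> shows that they agree if \<open>a + b < n\<close>, while for
  \<open>a + b \<ge> n\<close> they agree if \<open>z d = z \<sigma>\<^sup>c(d)\<close> (lemmas \<open>cocycle\<close> and \<open>associates\<close>), and
  \<open>a = n - 1\<close>, \<open>b = 1\<close> shows that this condition is necessary. Hence \<open>K\<close> lies in the nucleus, \<open>A\<close> is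
  associative if and only if \<open>\<sigma>(d) = d\<close>, and the right nucleus consists of the \<open>\<Sum> z\<^sub>c t\<^sup>c\<close> with
  \<open>z\<^sub>c (d - \<sigma>\<^sup>c(d)) = 0\<close> for all \<open>c\<close> (theorem \<open>nuc_r_eq\<close>).

  If \<open>d - \<sigma>\<^sup>c(d)\<close> is never a nonzero zero divisor, the right nucleus is therefore supported on the
  exponents \<open>c\<close> with \<open>\<sigma>\<^sup>c(d) = d\<close>, that is, on the multiples of \<open>s\<close>, and \<open>t \<mapsto> t\<^sup>s\<close> identifies it with
  \<open>K[t;\<sigma>\<^sup>s]/K[t;\<sigma>\<^sup>s](t\<^sup>r - d)\<close> (lemma \<open>subst_pow_iso\<close>). For general Galois \<open>C\<^sub>n\<close>-algebras zero divisors
  do occur; they are excluded because \<open>\<sigma>\<close> generates the full automorphism group. If \<open>K\<close> is a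
  product of at least two fields, then \<open>\<sigma>\<close> permutes the factors, and interchanging two of them while
  fixing the others is an automorphism which has to commute with \<open>\<sigma>\<close>. This leaves only a field or
  two factors with \<open>n = 2\<close>, where \<open>x - \<sigma>(x)\<close> is visibly zero or regular (theorem \<open>field_or_swap\<close>).

  If \<open>K\<close> is a field, the degrees \<open>[K:E] = r\<close> and \<open>[E:F] = s\<close> follow from Artin's inequalities
  \<open>[K:E] \<le> r\<close> and \<open>[E:F] \<le> s\<close> together with \<open>[K:F] = n = s r\<close> (lemmas \<open>artin_inequality\<close> and
  \<open>cyclic_tower\<close>). The elements of the left nucleus have vanishing coefficients at \<open>t\<^sup>a\<close> for \<open>a > 0\<close>,
  as one sees from their associators with \<open>t\<^sup>n\<^sup>-\<^sup>a\<close> and \<open>t\<close>; so the nucleus is \<open>K\<close>.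
\<close>

section \<open>Arithmetic in the algebra \<open>K[t;\<rho>]/K[t;\<rho>](t\<^sup>m - d)\<close>\<close>

lemma petit_carrier: "carrier (petit S \<rho> f) = polys_below S (deg S f)"
  by (simp add: petit_def)

lemma petit_add:
  "x \<in> up S \<Longrightarrow> y \<in> up S \<Longrightarrow> x \<oplus>\<^bsub>petit S \<rho> f\<^esub> y = (\<lambda>i. x i \<oplus>\<^bsub>S\<^esub> y i)"
  by (simp add: petit_def skew_UP_def UP_def)

lemma petit_zero: "\<zero>\<^bsub>petit S \<rho> f\<^esub> = (\<lambda>i. \<zero>\<^bsub>S\<^esub>)"
  by (simp add: petit_def skew_UP_def UP_def)

lemma petit_one: "\<one>\<^bsub>petit S \<rho> f\<^esub> = (\<lambda>i. if i = 0 then \<one>\<^bsub>S\<^esub> else \<zero>\<^bsub>S\<^esub>)"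
  by (simp add: petit_def skew_UP_def UP_def)

lemma petit_mult: "x \<otimes>\<^bsub>petit S \<rho> f\<^esub> y = right_rem S \<rho> f (x \<otimes>\<^bsub>skew_UP S \<rho>\<^esub> y)"
  by (simp add: petit_def)

text \<open>
  The algebra \<open>A = K[t;\<rho>]/K[t;\<rho>](t\<^sup>m - d)\<close> over a nonzero commutative ring \<open>K\<close> whose endomorphism
  \<open>\<rho>\<close> satisfies \<open>\<rho>\<^sup>m = 1\<close>.
\<close>

locale cyclic_petit = cring K for K (structure) +
  fixes \<rho> :: "'a \<Rightarrow> 'a" and m :: nat and d :: 'a
  assumes rho_hom: "\<rho> \<in> ring_hom K K"
    and rho_period: "x \<in> carrier K \<Longrightarrow> (\<rho> ^^ m) x = x"
    and m_pos: "0 < m"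
    and d_closed: "d \<in> carrier K"
    and nontriv: "\<one> \<noteq> \<zero>"
begin

abbreviation "A \<equiv> cyclic_alg K \<rho> m d"

lemma rho_pow_closed [simp, intro]: "x \<in> carrier K \<Longrightarrow> (\<rho> ^^ i) x \<in> carrier K"
  using rho_hom by (induct i) (auto dest: ring_hom_closed)

lemma rho_pow_mult [simp]:
  "x \<in> carrier K \<Longrightarrow> y \<in> carrier K \<Longrightarrow> (\<rho> ^^ i) (x \<otimes> y) = (\<rho> ^^ i) x \<otimes> (\<rho> ^^ i) y"
  by (induct i) (auto simp: ring_hom_mult[OF rho_hom])

lemma rho_pow_add [simp]:
  "x \<in> carrier K \<Longrightarrow> y \<in> carrier K \<Longrightarrow> (\<rho> ^^ i) (x \<oplus> y) = (\<rho> ^^ i) x \<oplus> (\<rho> ^^ i) y"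
  by (induct i) (auto simp: ring_hom_add[OF rho_hom])

lemma rho_pow_one [simp]: "(\<rho> ^^ i) \<one> = \<one>"
  by (induct i) (auto simp: ring_hom_one[OF rho_hom])

lemma rho_pow_zero [simp]: "(\<rho> ^^ i) \<zero> = \<zero>"
  using ring_hom_zero[OF rho_hom ring_axioms ring_axioms] by (induct i) auto

lemma rho_pow_pow: "(\<rho> ^^ i) ((\<rho> ^^ j) x) = (\<rho> ^^ (i + j)) x"
  by (simp add: funpow_add)

lemma rho_pow_finsum:
  "finite I \<Longrightarrow> (\<And>i. i \<in> I \<Longrightarrow> f i \<in> carrier K) \<Longrightarrow>
    (\<rho> ^^ j) (\<Oplus>i\<in>I. f i) = (\<Oplus>i\<in>I. (\<rho> ^^ j) (f i))"
  by (induct I rule: finite_induct) (auto simp: finsum_insert Pi_def)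

lemma rho_pow_add_period: "x \<in> carrier K \<Longrightarrow> (\<rho> ^^ (i + m)) x = (\<rho> ^^ i) x"
  using rho_period by (simp add: funpow_add)

text \<open>The polynomial \<open>t\<^sup>m - d\<close>\<close>

definition f_pol where "f_pol = up_ring.monom (UP K) \<one> m \<ominus>\<^bsub>UP K\<^esub> const_poly K d"

lemma f_pol_closed: "f_pol \<in> carrier (UP K)"
proof -
  interpret P: UP_cring K "UP K" by unfold_locales simp
  show ?thesis by (simp add: f_pol_def const_poly_def d_closed)
qed

lemma up_carrier: "carrier (UP K) = up K"
  by (simp add: UP_def)

lemma coeff_up: "p \<in> up K \<Longrightarrow> up_ring.coeff (UP K) p i = p i"
  by (simp add: UP_def)

lemma f_pol_up: "f_pol \<in> up K"
  using f_pol_closed unfolding up_carrier .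

lemma f_pol_coeff: "f_pol i = (if i = m then \<one> else if i = 0 then \<ominus> d else \<zero>)"
proof -
  interpret P: UP_cring K "UP K" by unfold_locales simp
  have "f_pol i = up_ring.coeff (UP K) f_pol i"
    by (rule coeff_up[OF f_pol_up, symmetric])
  also have "\<dots> = (if i = m then \<one> else if i = 0 then \<ominus> d else \<zero>)"
    using m_pos by (auto simp add: f_pol_def const_poly_def d_closed a_minus_def)
  finally show ?thesis .
qed

lemma deg_f_pol: "deg K f_pol = m"
proof -
  interpret P: UP_cring K "UP K" by unfold_locales simp
  show ?thesis
    using f_pol_closed nontriv m_pos
    by (intro P.deg_aboveI P.deg_belowI le_antisym) (simp_all add: coeff_up[OF f_pol_up] f_pol_coeff)
qed

lemma alg_petit: "A = petit K \<rho> f_pol"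
  by (simp add: cyclic_alg_def f_pol_def)

lemma mem_carrier_alg: "x \<in> carrier A \<longleftrightarrow> (\<forall>i. x i \<in> carrier K) \<and> (\<forall>i\<ge>m. x i = \<zero>)"
proof -
  have "carrier A = polys_below K m"
    by (simp add: alg_petit petit_carrier deg_f_pol)
  moreover have "x \<in> up K" if "\<forall>i. x i \<in> carrier K" "\<forall>i\<ge>m. x i = \<zero>"
    using that by (intro mem_upI exI[of _ m]) auto
  ultimately show ?thesis
    by (auto simp: polys_below_def coeff_up dest: mem_upD)
qed

lemma alg_closed [simp]: "x \<in> carrier A \<Longrightarrow> x i \<in> carrier K"
  by (simp add: mem_carrier_alg)

lemma alg_above [simp]: "x \<in> carrier A \<Longrightarrow> m \<le> i \<Longrightarrow> x i = \<zero>"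
  by (simp add: mem_carrier_alg)

lemma alg_up: "x \<in> carrier A \<Longrightarrow> x \<in> up K"
  by (rule mem_upI, simp, rule exI[of _ m], rule bound.intro) simp

lemma add_alg: "x \<in> carrier A \<Longrightarrow> y \<in> carrier A \<Longrightarrow> x \<oplus>\<^bsub>A\<^esub> y = (\<lambda>i. x i \<oplus> y i)"
  by (drule alg_up, drule alg_up) (unfold alg_petit, rule petit_add)

lemma zero_alg: "\<zero>\<^bsub>A\<^esub> = (\<lambda>i. \<zero>)"
  by (simp add: alg_petit petit_zero)

lemma one_alg: "\<one>\<^bsub>A\<^esub> = (\<lambda>i. if i = 0 then \<one> else \<zero>)"
  by (simp add: alg_petit petit_one)

text \<open>
  The cocycle of the algebra: for \<open>i, k < m\<close> the product of \<open>t\<^sup>i\<close> with the power of \<open>t\<close> of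
  exponent \<open>(k - i) mod m\<close> is \<open>tw i k t\<^sup>k\<close>.
\<close>

definition tw :: "nat \<Rightarrow> nat \<Rightarrow> 'a" where
  "tw i k = (if i \<le> k then \<one> else (\<rho> ^^ k) d)"

lemma tw_closed [simp, intro]: "tw i k \<in> carrier K"
  by (simp add: tw_def d_closed)

lemma skew_mult:
  "p \<in> up K \<Longrightarrow> q \<in> up K \<Longrightarrow>
    p \<otimes>\<^bsub>skew_UP K \<rho>\<^esub> q = (\<lambda>k. \<Oplus>i\<in>{..k}. p i \<otimes> (\<rho> ^^ i) (q (k - i)))"
  by (simp add: skew_UP_def)

lemma finsum_two:
  assumes "finite I" "a \<in> I" "b \<in> I" "a \<noteq> b" "\<And>i. i \<in> I \<Longrightarrow> i \<noteq> a \<Longrightarrow> i \<noteq> b \<Longrightarrow> f i = \<zero>"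
    "\<And>i. i \<in> I \<Longrightarrow> f i \<in> carrier K"
  shows "(\<Oplus>i\<in>I. f i) = f a \<oplus> f b"
proof -
  have "(\<Oplus>i\<in>I. f i) = (\<Oplus>i\<in>{a, b}. f i)"
    using assms by (intro add.finprod_mono_neutral_cong_right) auto
  also have "\<dots> = f a \<oplus> f b"
    using assms by (simp add: finsum_insert)
  finally show ?thesis .
qed

lemma skew_mult_f_pol:
  assumes q: "q \<in> up K"
  shows "q \<otimes>\<^bsub>skew_UP K \<rho>\<^esub> f_pol =
    (\<lambda>k. (if m \<le> k then q (k - m) else \<zero>) \<ominus> q k \<otimes> (\<rho> ^^ k) d)"
proof
  fix k
  have qc: "\<And>i. q i \<in> carrier K" using q by auto
  have neg: "(\<rho> ^^ k) (\<ominus> d) = \<ominus> (\<rho> ^^ k) d"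
    by (metis d_closed add.inv_closed minus_equality rho_pow_add rho_pow_closed rho_pow_zero l_neg)
  have "(q \<otimes>\<^bsub>skew_UP K \<rho>\<^esub> f_pol) k = (\<Oplus>i\<in>{..k}. q i \<otimes> (\<rho> ^^ i) (f_pol (k - i)))"
    by (simp add: skew_mult q f_pol_up)
  also have "\<dots> = (if m \<le> k then q (k - m) else \<zero>) \<ominus> q k \<otimes> (\<rho> ^^ k) d"
  proof (cases "m \<le> k")
    case True
    have "(\<Oplus>i\<in>{..k}. q i \<otimes> (\<rho> ^^ i) (f_pol (k - i))) =
      q (k - m) \<otimes> (\<rho> ^^ (k - m)) (f_pol (k - (k - m))) \<oplus> q k \<otimes> (\<rho> ^^ k) (f_pol (k - k))"
      using m_pos True qc d_closed by (intro finsum_two) (auto simp: f_pol_coeff)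
    then show ?thesis
      using True m_pos qc d_closed by (simp add: f_pol_coeff neg a_minus_def r_minus)
  next
    case False
    have "(\<Oplus>i\<in>{..k}. q i \<otimes> (\<rho> ^^ i) (f_pol (k - i))) =
      (\<Oplus>i\<in>{k}. q i \<otimes> (\<rho> ^^ i) (f_pol (k - i)))"
      using m_pos False qc d_closed
      by (intro add.finprod_mono_neutral_cong_right) (auto simp: f_pol_coeff)
    then show ?thesis
      using False m_pos qc d_closed by (simp add: f_pol_coeff neg a_minus_def r_minus)
  qed
  finally show "(q \<otimes>\<^bsub>skew_UP K \<rho>\<^esub> f_pol) k =
    (if m \<le> k then q (k - m) else \<zero>) \<ominus> q k \<otimes> (\<rho> ^^ k) d" .
qed

lemma skew_mult_f_pol_closed:
  assumes q: "q \<in> up K"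
  shows "q \<otimes>\<^bsub>skew_UP K \<rho>\<^esub> f_pol \<in> up K"
proof -
  obtain N where N: "bound \<zero> N q" using q by auto
  have "bound \<zero> (N + m) (\<lambda>k. (if m \<le> k then q (k - m) else \<zero>) \<ominus> q k \<otimes> (\<rho> ^^ k) d)"
    by (rule bound.intro) (use N d_closed in \<open>auto simp: bound_def a_minus_def\<close>)
  then show ?thesis
    unfolding skew_mult_f_pol[OF q] using q d_closed by (intro mem_upI exI) auto
qed

lemma skew_add:
  "p \<in> up K \<Longrightarrow> q \<in> up K \<Longrightarrow> p \<oplus>\<^bsub>skew_UP K \<rho>\<^esub> q = (\<lambda>k. p k \<oplus> q k)"
  by (simp add: skew_UP_def UP_def)

text \<open>
  Multiples of \<open>t\<^sup>m - d\<close> which agree from degree \<open>m\<close> on have the same cofactor: the coefficient of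
  the cofactor at \<open>i\<close> is determined by the one at \<open>i + m\<close>, and almost all of them vanish.
\<close>

lemma cofactor_unique:
  assumes q: "q \<in> up K" "q' \<in> up K"
    and eq: "\<And>k. m \<le> k \<Longrightarrow> (q \<otimes>\<^bsub>skew_UP K \<rho>\<^esub> f_pol) k = (q' \<otimes>\<^bsub>skew_UP K \<rho>\<^esub> f_pol) k"
  shows "q = q'"
proof -
  have qc: "\<And>i. q i \<in> carrier K" "\<And>i. q' i \<in> carrier K" using q by auto
  obtain N where N: "bound \<zero> N q" using q by auto
  obtain N' where N': "bound \<zero> N' q'" using q by auto
  have "q i = q' i" for i
  proof (induct "N + N' + 1 - i" arbitrary: i rule: less_induct)
    case less
    show ?case
    proof (cases "i < N + N' + 1")
      case False
      then show ?thesis using N N' by (auto simp: bound_def)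
    next
      case True
      then have "q (i + m) = q' (i + m)" using m_pos by (intro less) auto
      with eq[of "i + m"] have "q i \<ominus> q' (i + m) \<otimes> (\<rho> ^^ (i + m)) d =
        q' i \<ominus> q' (i + m) \<otimes> (\<rho> ^^ (i + m)) d"
        by (simp add: skew_mult_f_pol q)
      then show ?thesis using qc d_closed by (simp add: a_minus_def)
    qed
  qed
  then show ?thesis by auto
qed

text \<open>
  The product of two polynomials of degree less than \<open>m\<close> has degree less than \<open>2 m\<close>; then
  \<open>t\<^sup>k\<^sup>+\<^sup>m = t\<^sup>k (t\<^sup>m - d) + \<rho>\<^sup>k(d) t\<^sup>k\<close> gives the remainder.
\<close>

lemma right_rem_f_pol:
  assumes u: "u \<in> up K" and deg: "\<And>k. 2 * m \<le> k \<Longrightarrow> u k = \<zero>"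
  shows "right_rem K \<rho> f_pol u =
    (\<lambda>k. if k < m then u k \<oplus> u (k + m) \<otimes> (\<rho> ^^ k) d else \<zero>)" (is "_ = ?r")
proof -
  have uc: "\<And>i. u i \<in> carrier K" using u by auto
  define q where "q = (\<lambda>k. u (k + m))"
  have q_above: "\<And>k. m \<le> k \<Longrightarrow> q k = \<zero>" by (simp add: q_def deg)
  have q: "q \<in> up K"
    by (rule mem_upI) (use uc q_above in \<open>auto simp: q_def intro!: exI[of _ m]\<close>)
  have r: "?r \<in> up K"
    by (rule mem_upI) (use uc d_closed in \<open>auto intro!: exI[of _ m]\<close>)
  have rb: "?r \<in> polys_below K m"
    using r by (auto simp: polys_below_def coeff_up)
  show ?thesis
    unfolding right_rem_def deg_f_pol
  proof (rule the_equality, intro conjI bexI)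
    show "?r \<in> polys_below K m" by (rule rb)
    show "q \<in> up K" by (rule q)
    show "u = (q \<otimes>\<^bsub>skew_UP K \<rho>\<^esub> f_pol) \<oplus>\<^bsub>skew_UP K \<rho>\<^esub> ?r"
    proof
      fix k
      have "((q \<otimes>\<^bsub>skew_UP K \<rho>\<^esub> f_pol) \<oplus>\<^bsub>skew_UP K \<rho>\<^esub> ?r) k =
        ((if m \<le> k then q (k - m) else \<zero>) \<ominus> q k \<otimes> (\<rho> ^^ k) d) \<oplus> ?r k"
        by (subst skew_add[OF skew_mult_f_pol_closed[OF q] r]) (simp add: skew_mult_f_pol[OF q])
      also have "\<dots> = u k"
      proof (cases "m \<le> k")
        case True
        then show ?thesis using uc d_closed q_above by (simp add: q_def a_minus_def)
      next
        case False
        then show ?thesis using uc d_closed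
          by (simp add: q_def a_minus_def a_lcomm[of _ "u k"] l_neg)
      qed
      finally show "u k = ((q \<otimes>\<^bsub>skew_UP K \<rho>\<^esub> f_pol) \<oplus>\<^bsub>skew_UP K \<rho>\<^esub> ?r) k" by simp
    qed
  next
    fix r' assume r': "r' \<in> polys_below K m \<and>
      (\<exists>q\<in>up K. u = (q \<otimes>\<^bsub>skew_UP K \<rho>\<^esub> f_pol) \<oplus>\<^bsub>skew_UP K \<rho>\<^esub> r')"
    then obtain q' where q': "q' \<in> up K" and u': "u = (q' \<otimes>\<^bsub>skew_UP K \<rho>\<^esub> f_pol) \<oplus>\<^bsub>skew_UP K \<rho>\<^esub> r'"
      by auto
    have r'up: "r' \<in> up K" and r'0: "\<And>k. m \<le> k \<Longrightarrow> r' k = \<zero>"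
      using r' by (auto simp: polys_below_def coeff_up)
    have c: "\<And>k. (q' \<otimes>\<^bsub>skew_UP K \<rho>\<^esub> f_pol) k \<in> carrier K" "\<And>k. r' k \<in> carrier K"
      using skew_mult_f_pol_closed[OF q'] r'up by auto
    have uk: "u k = (q' \<otimes>\<^bsub>skew_UP K \<rho>\<^esub> f_pol) k \<oplus> r' k" for k
      by (subst u') (simp add: skew_add skew_mult_f_pol_closed q' r'up)
    have "q' = q"
    proof (rule cofactor_unique[OF q' q])
      fix k assume k: "m \<le> k"
      then have "(q' \<otimes>\<^bsub>skew_UP K \<rho>\<^esub> f_pol) k = u k" using uk[of k] r'0 c by simp
      also have "\<dots> = (q \<otimes>\<^bsub>skew_UP K \<rho>\<^esub> f_pol) k"
        using k q_above uc d_closed by (simp add: skew_mult_f_pol[OF q]) (simp add: q_def a_minus_def)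
      finally show "(q' \<otimes>\<^bsub>skew_UP K \<rho>\<^esub> f_pol) k = (q \<otimes>\<^bsub>skew_UP K \<rho>\<^esub> f_pol) k" .
    qed
    show "r' = ?r"
    proof
      fix k
      show "r' k = ?r k"
      proof (cases "k < m")
        case True
        then have "u k = (\<ominus> (u (k + m) \<otimes> (\<rho> ^^ k) d)) \<oplus> r' k"
          using uk[of k] uc d_closed unfolding \<open>q' = q\<close>
          by (simp add: skew_mult_f_pol[OF q]) (simp add: q_def a_minus_def)
        then show ?thesis using True uc c d_closed
          by (simp add: a_comm[of _ "u (k + m) \<otimes> (\<rho> ^^ k) d"] r_neg1 r_neg2)
      next
        case False
        then show ?thesis using r'0 by simp
      qed
    qed
  qed
qed

lemma finsum_restrict:
  "finite I \<Longrightarrow> (\<And>i. i \<in> I \<Longrightarrow> f i \<in> carrier K) \<Longrightarrow> J \<subseteq> I \<Longrightarrow>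
    (\<And>i. i \<in> I \<Longrightarrow> i \<notin> J \<Longrightarrow> f i = \<zero>) \<Longrightarrow> (\<Oplus>i\<in>I. f i) = (\<Oplus>i\<in>J. f i)"
  by (rule add.finprod_mono_neutral_cong_right) auto

text \<open>
  The two terms of the remainder merge into a single sum over residues modulo \<open>m\<close>, which is the
  form of the product that is used in the sequel.
\<close>

lemma mult_alg:
  assumes x: "x \<in> carrier A" and y: "y \<in> carrier A"
  shows "x \<otimes>\<^bsub>A\<^esub> y = (\<lambda>k. if k < m
    then \<Oplus>i\<in>{..<m}. x i \<otimes> (\<rho> ^^ i) (y ((m + k - i) mod m)) \<otimes> tw i k else \<zero>)"
proof -
  define u where "u = (\<lambda>k. \<Oplus>i\<in>{..k}. x i \<otimes> (\<rho> ^^ i) (y (k - i)))"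
  have u0: "u k = \<zero>" if "2 * m \<le> k" for k
    unfolding u_def
  proof (rule add.finprod_one_eqI)
    fix i assume "i \<in> {..k}"
    with that have "m \<le> i \<or> m \<le> k - i" by auto
    then show "x i \<otimes> (\<rho> ^^ i) (y (k - i)) = \<zero>" using x y by auto
  qed
  have uc: "u k \<in> carrier K" for k
    unfolding u_def using x y by (intro finsum_closed) auto
  have u: "u \<in> up K"
    by (rule mem_upI) (use uc u0 in \<open>auto intro!: exI[of _ "2 * m"]\<close>)
  have "x \<otimes>\<^bsub>A\<^esub> y = right_rem K \<rho> f_pol u"
    unfolding alg_petit petit_mult u_def skew_mult[OF alg_up[OF x] alg_up[OF y]] by (rule refl)
  also have "\<dots> = (\<lambda>k. if k < m then u k \<oplus> u (k + m) \<otimes> (\<rho> ^^ k) d else \<zero>)"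
    by (rule right_rem_f_pol[OF u u0])
  also have "\<dots> = (\<lambda>k. if k < m
    then \<Oplus>i\<in>{..<m}. x i \<otimes> (\<rho> ^^ i) (y ((m + k - i) mod m)) \<otimes> tw i k else \<zero>)"
  proof
    fix k
    show "(if k < m then u k \<oplus> u (k + m) \<otimes> (\<rho> ^^ k) d else \<zero>) = (if k < m
      then \<Oplus>i\<in>{..<m}. x i \<otimes> (\<rho> ^^ i) (y ((m + k - i) mod m)) \<otimes> tw i k else \<zero>)"
    proof (cases "k < m")
      case k: True
      let ?h = "\<lambda>i. x i \<otimes> (\<rho> ^^ i) (y ((m + k - i) mod m)) \<otimes> tw i k"
      have hc: "?h i \<in> carrier K" for i using x y by auto
      have "u k = (\<Oplus>i\<in>{..k}. ?h i)"
        unfolding u_def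
      proof (rule finsum_cong')
        fix i assume "i \<in> {..k}"
        then have i: "i \<le> k" "m + k - i = m + (k - i)" "k - i < m" using k by auto
        have "(m + k - i) mod m = k - i" unfolding i(2) using i(3) by simp
        note i(1) this
        then show "x i \<otimes> (\<rho> ^^ i) (y (k - i)) = ?h i" using x y by (simp add: tw_def)
      qed (use hc in auto)
      moreover have "u (k + m) \<otimes> (\<rho> ^^ k) d = (\<Oplus>i\<in>{k<..<m}. ?h i)"
      proof -
        have "u (k + m) = (\<Oplus>i\<in>{k<..<m}. x i \<otimes> (\<rho> ^^ i) (y (k + m - i)))"
          unfolding u_def
        proof (rule finsum_restrict)
          fix i assume i: "i \<in> {..k + m}" "i \<notin> {k<..<m}"
          then have "m \<le> i \<or> m \<le> k + m - i" by auto
          then show "x i \<otimes> (\<rho> ^^ i) (y (k + m - i)) = \<zero>" using x y by auto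
        qed (use x y in auto)
        then have "u (k + m) \<otimes> (\<rho> ^^ k) d =
          (\<Oplus>i\<in>{k<..<m}. x i \<otimes> (\<rho> ^^ i) (y (k + m - i)) \<otimes> (\<rho> ^^ k) d)"
          using x y d_closed by (simp add: finsum_ldistr Pi_def)
        also have "\<dots> = (\<Oplus>i\<in>{k<..<m}. ?h i)"
        proof (rule finsum_cong')
          fix i assume "i \<in> {k<..<m}"
          then have "(m + k - i) mod m = k + m - i" "\<not> i \<le> k" using k by (auto simp: add.commute)
          then show "x i \<otimes> (\<rho> ^^ i) (y (k + m - i)) \<otimes> (\<rho> ^^ k) d = ?h i"
            using x y by (simp add: tw_def)
        qed (use hc in auto)
        finally show ?thesis .
      qed
      moreover have "(\<Oplus>i\<in>{..k} \<union> {k<..<m}. ?h i) = (\<Oplus>i\<in>{..k}. ?h i) \<oplus> (\<Oplus>i\<in>{k<..<m}. ?h i)"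
        using hc by (intro finsum_Un_disjoint) auto
      moreover have "{..k} \<union> {k<..<m} = {..<m}" using k by auto
      ultimately show ?thesis using k by simp
    qed simp
  qed
  finally show ?thesis .
qed

end

section \<open>Ring structure and associativity\<close>

lemma (in abelian_monoid) finsum_swap:
  assumes "finite I" "finite J" "\<And>i j. i \<in> I \<Longrightarrow> j \<in> J \<Longrightarrow> g i j \<in> carrier G"
  shows "(\<Oplus>i\<in>I. \<Oplus>j\<in>J. g i j) = (\<Oplus>j\<in>J. \<Oplus>i\<in>I. g i j)"
  using assms(1,3)
proof (induct I rule: finite_induct)
  case empty
  then show ?case by (simp add: finsum_zero)
next
  case (insert a I)
  have "(\<Oplus>i\<in>insert a I. \<Oplus>j\<in>J. g i j) = (\<Oplus>j\<in>J. g a j) \<oplus> (\<Oplus>j\<in>J. \<Oplus>i\<in>I. g i j)"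
    using insert by (simp add: finsum_insert Pi_def finsum_closed)
  also have "\<dots> = (\<Oplus>j\<in>J. g a j \<oplus> (\<Oplus>i\<in>I. g i j))"
    using insert by (intro finsum_addf[symmetric]) (auto intro!: finsum_closed)
  also have "\<dots> = (\<Oplus>j\<in>J. \<Oplus>i\<in>insert a I. g i j)"
    using insert by (intro finsum_cong') (auto simp: finsum_insert Pi_def intro!: finsum_closed)
  finally show ?case .
qed

lemma (in abelian_group) minus_zero_iff:
  assumes "x \<in> carrier G" "y \<in> carrier G"
  shows "x \<ominus> y = \<zero> \<longleftrightarrow> x = y"
proof
  assume "x \<ominus> y = \<zero>"
  then show "x = y"
    using assms minus_equality[of x "\<ominus> y"] by (simp add: a_minus_def)
qed (use assms in \<open>simp add: a_minus_def r_neg\<close>)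

context cyclic_petit
begin

lemma alg_memI: "(\<And>i. x i \<in> carrier K) \<Longrightarrow> (\<And>i. m \<le> i \<Longrightarrow> x i = \<zero>) \<Longrightarrow> x \<in> carrier A"
  by (simp only: mem_carrier_alg) blast

lemma mult_app:
  "x \<in> carrier A \<Longrightarrow> y \<in> carrier A \<Longrightarrow> k < m \<Longrightarrow>
    (x \<otimes>\<^bsub>A\<^esub> y) k = (\<Oplus>i\<in>{..<m}. x i \<otimes> (\<rho> ^^ i) (y ((m + k - i) mod m)) \<otimes> tw i k)"
  by (simp add: mult_alg)

lemma alg_mult_closed [simp, intro]:
  assumes "x \<in> carrier A" "y \<in> carrier A"
  shows "x \<otimes>\<^bsub>A\<^esub> y \<in> carrier A"
proof -
  have "(\<Oplus>i\<in>{..<m}. x i \<otimes> (\<rho> ^^ i) (y ((m + k - i) mod m)) \<otimes> tw i k) \<in> carrier K" for k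
    using assms by (intro finsum_closed) auto
  then show ?thesis unfolding mult_alg[OF assms] by (intro alg_memI) auto
qed

lemma alg_eqI:
  "x \<in> carrier A \<Longrightarrow> y \<in> carrier A \<Longrightarrow> (\<And>k. k < m \<Longrightarrow> x k = y k) \<Longrightarrow> x = y"
  by (rule ext) (metis alg_above not_less)

lemma alg_add_closed [simp, intro]: "x \<in> carrier A \<Longrightarrow> y \<in> carrier A \<Longrightarrow> x \<oplus>\<^bsub>A\<^esub> y \<in> carrier A"
  unfolding add_alg by (intro alg_memI) auto

lemma alg_one_closed [simp, intro]: "\<one>\<^bsub>A\<^esub> \<in> carrier A"
  unfolding one_alg using m_pos by (intro alg_memI) auto

lemma add_app: "x \<in> carrier A \<Longrightarrow> y \<in> carrier A \<Longrightarrow> (x \<oplus>\<^bsub>A\<^esub> y) i = x i \<oplus> y i"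
  by (simp add: add_alg)

lemma alg_abelian_group: "abelian_group A"
proof (rule abelian_groupI)
  show "\<zero>\<^bsub>A\<^esub> \<in> carrier A" unfolding zero_alg by (intro alg_memI) auto
  fix x y z assume c: "x \<in> carrier A" "y \<in> carrier A" "z \<in> carrier A"
  show "x \<oplus>\<^bsub>A\<^esub> y \<oplus>\<^bsub>A\<^esub> z = x \<oplus>\<^bsub>A\<^esub> (y \<oplus>\<^bsub>A\<^esub> z)"
    using c by (intro ext) (simp add: add_app a_assoc)
next
  fix x y assume c: "x \<in> carrier A" "y \<in> carrier A"
  show "x \<oplus>\<^bsub>A\<^esub> y \<in> carrier A" using c by simp
  show "x \<oplus>\<^bsub>A\<^esub> y = y \<oplus>\<^bsub>A\<^esub> x"
    using c by (simp add: add_alg a_comm)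
next
  fix x assume c: "x \<in> carrier A"
  have z: "\<zero>\<^bsub>A\<^esub> \<in> carrier A" unfolding zero_alg by (intro alg_memI) auto
  show "\<zero>\<^bsub>A\<^esub> \<oplus>\<^bsub>A\<^esub> x = x"
    using c z by (intro ext) (simp add: add_app zero_alg)
  show "\<exists>y\<in>carrier A. y \<oplus>\<^bsub>A\<^esub> x = \<zero>\<^bsub>A\<^esub>"
  proof
    show n: "(\<lambda>i. \<ominus> x i) \<in> carrier A" using c by (intro alg_memI) auto
    show "(\<lambda>i. \<ominus> x i) \<oplus>\<^bsub>A\<^esub> x = \<zero>\<^bsub>A\<^esub>"
      using c n by (simp add: add_alg zero_alg l_neg)
  qed
qed

sublocale AG: abelian_group A
  by (rule alg_abelian_group)

lemma alg_l_distr: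
  assumes "x \<in> carrier A" "y \<in> carrier A" "z \<in> carrier A"
  shows "(x \<oplus>\<^bsub>A\<^esub> y) \<otimes>\<^bsub>A\<^esub> z = x \<otimes>\<^bsub>A\<^esub> z \<oplus>\<^bsub>A\<^esub> y \<otimes>\<^bsub>A\<^esub> z"
  by (rule alg_eqI)
     (use assms in \<open>simp_all add: mult_app add_app l_distr finsum_addf Pi_def\<close>)

lemma alg_r_distr:
  assumes "x \<in> carrier A" "y \<in> carrier A" "z \<in> carrier A"
  shows "z \<otimes>\<^bsub>A\<^esub> (x \<oplus>\<^bsub>A\<^esub> y) = z \<otimes>\<^bsub>A\<^esub> x \<oplus>\<^bsub>A\<^esub> z \<otimes>\<^bsub>A\<^esub> y"
  by (rule alg_eqI)
     (use assms in \<open>simp_all add: mult_app add_app l_distr r_distr finsum_addf Pi_def\<close>)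

text \<open>The element \<open>a t\<^sup>i\<close>\<close>

definition mon :: "'a \<Rightarrow> nat \<Rightarrow> nat \<Rightarrow> 'a" where
  "mon a i = (\<lambda>j. if j = i then a else \<zero>)"

lemma mon_closed [simp, intro]: "a \<in> carrier K \<Longrightarrow> i < m \<Longrightarrow> mon a i \<in> carrier A"
  unfolding mon_def by (intro alg_memI) auto

lemma const_poly_mon: "a \<in> carrier K \<Longrightarrow> const_poly K a = mon a 0"
  by (auto simp: const_poly_def UP_def mon_def)

lemma one_mon: "\<one>\<^bsub>A\<^esub> = mon \<one> 0"
  by (simp add: one_alg mon_def)

lemma mod_diff:
  assumes "i < m" "k < m"
  shows "(m + k - i) mod m = (if i \<le> k then k - i else m + k - i)"
proof (cases "i \<le> k")
  case True
  then have *: "m + k - i = m + (k - i)" by simp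
  have "(m + (k - i)) mod m = k - i" using assms by simp
  then show ?thesis unfolding * using True by simp
qed (use assms in simp)

lemma mod_add_sub: "i < m \<Longrightarrow> j < m \<Longrightarrow> (m + (i + j) mod m - i) mod m = j"
  by (cases "i + j < m") (simp_all add: mod_if)

lemma mod_diff_swap:
  "i < m \<Longrightarrow> j < m \<Longrightarrow> k < m \<Longrightarrow> (m + k - i) mod m = j \<longleftrightarrow> i = (m + k - j) mod m"
  by (auto simp: mod_diff split: if_splits)

lemma mon_mult_app:
  assumes "a \<in> carrier K" "i < m" "y \<in> carrier A" "k < m"
  shows "(mon a i \<otimes>\<^bsub>A\<^esub> y) k = a \<otimes> (\<rho> ^^ i) (y ((m + k - i) mod m)) \<otimes> tw i k"
proof -
  have "(mon a i \<otimes>\<^bsub>A\<^esub> y) k =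
    (\<Oplus>j\<in>{i}. mon a i j \<otimes> (\<rho> ^^ j) (y ((m + k - j) mod m)) \<otimes> tw j k)"
    unfolding mult_app[OF mon_closed[OF assms(1,2)] assms(3,4)]
    using assms by (intro finsum_restrict) (auto simp: mon_def)
  then show ?thesis using assms by (simp add: mon_def)
qed

lemma mult_mon_app:
  assumes "b \<in> carrier K" "j < m" "x \<in> carrier A" "k < m" and i: "i = (m + k - j) mod m"
  shows "(x \<otimes>\<^bsub>A\<^esub> mon b j) k = x i \<otimes> (\<rho> ^^ i) b \<otimes> tw i k"
proof -
  have im: "i < m" using i m_pos by simp
  have "(x \<otimes>\<^bsub>A\<^esub> mon b j) k =
    (\<Oplus>l\<in>{i}. x l \<otimes> (\<rho> ^^ l) (mon b j ((m + k - l) mod m)) \<otimes> tw l k)"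
    unfolding mult_app[OF assms(3) mon_closed[OF assms(1,2)] assms(4)]
    using assms im by (intro finsum_restrict) (auto simp: mon_def mod_diff_swap)
  then show ?thesis using assms(1-4) im mod_diff_swap[OF im assms(2,4)] i by (simp add: mon_def)
qed

lemma alg_l_one: "x \<in> carrier A \<Longrightarrow> \<one>\<^bsub>A\<^esub> \<otimes>\<^bsub>A\<^esub> x = x"
  by (rule alg_eqI) (simp_all add: one_mon mon_mult_app m_pos tw_def)

lemma alg_r_one: "x \<in> carrier A \<Longrightarrow> x \<otimes>\<^bsub>A\<^esub> \<one>\<^bsub>A\<^esub> = x"
  by (rule alg_eqI) (simp_all add: one_mon mult_mon_app[OF _ _ _ _ refl] m_pos tw_def)

lemma associator_zero_iff:
  "x \<in> carrier A \<Longrightarrow> y \<in> carrier A \<Longrightarrow> z \<in> carrier A \<Longrightarrow>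
    associator A x y z = \<zero>\<^bsub>A\<^esub> \<longleftrightarrow> (x \<otimes>\<^bsub>A\<^esub> y) \<otimes>\<^bsub>A\<^esub> z = x \<otimes>\<^bsub>A\<^esub> (y \<otimes>\<^bsub>A\<^esub> z)"
  unfolding associator_def by (intro AG.minus_zero_iff) auto

lemma ring_if_associative:
  assumes "associative_alg A"
  shows "ring A"
proof (rule ringI[OF alg_abelian_group])
  show "monoid A"
    using assms by (unfold_locales)
      (auto simp: alg_l_one alg_r_one associative_alg_def associator_zero_iff)
qed (auto simp: alg_l_distr alg_r_distr)

text \<open>
  The three monomials \<open>x t\<^sup>a\<close>, \<open>y t\<^sup>b\<close>, \<open>z t\<^sup>c\<close> associate as soon as \<open>a + b < m\<close> or
  \<open>z d = z \<rho>\<^sup>c(d)\<close>; here \<open>i\<close> and \<open>k\<close> are the exponents of the first product and of the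
  triple product.
\<close>

lemma cocycle:
  assumes ab: "a < m" "b < m" "c < m" and i: "i = (a + b) mod m" and k: "k = (i + c) mod m"
    and z: "z \<in> carrier K"
    and cond: "a + b < m \<or> z \<otimes> d = z \<otimes> (\<rho> ^^ c) d"
  shows "(\<rho> ^^ i) z \<otimes> (tw a i \<otimes> tw i k) =
    (\<rho> ^^ i) z \<otimes> ((\<rho> ^^ a) (tw b ((b + c) mod m)) \<otimes> tw a k)"
proof -
  have mod: "u mod m = (if u < m then u else u - m)" if "u < 2 * m" for u
    using that by (auto simp: mod_if)
  have i': "i = (if a + b < m then a + b else a + b - m)" using i ab mod by simp
  then have im: "i < m" using ab by auto
  have k': "k = (if i + c < m then i + c else i + c - m)" using k ab im mod by simp
  have bc: "(b + c) mod m = (if b + c < m then b + c else b + c - m)" using ab mod by simp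
  have tw: "(\<rho> ^^ a) (tw b ((b + c) mod m)) =
    (if b + c < m then \<one> else (\<rho> ^^ (a + (b + c - m))) d)"
    using ab by (auto simp: tw_def bc rho_pow_pow)
  show ?thesis
  proof (cases "a + b < m")
    case True
    then have i'': "i = a + b" using i' by simp
    have "tw a i \<otimes> tw i k = (\<rho> ^^ a) (tw b ((b + c) mod m)) \<otimes> tw a k"
    proof (cases "a + b + c < m")
      case True
      then have "k = a + b + c" using i'' k' by simp
      then show ?thesis unfolding tw using True i'' by (auto simp: tw_def)
    next
      case False
      then have k'': "k = a + b + c - m" using i'' k' by simp
      show ?thesis
      proof (cases "b + c < m")
        case bc: True
        then have "\<not> a \<le> k" using k'' False by auto
        then show ?thesis unfolding tw using bc i'' d_closed by (auto simp: tw_def)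
      next
        case bc: False
        then have "a \<le> k" "\<not> i \<le> k" "a + (b + c - m) = k" using k'' i'' ab by auto
        then show ?thesis unfolding tw using bc i'' d_closed by (auto simp: tw_def)
      qed
    qed
    then show ?thesis by simp
  next
    case False
    then have zd: "z \<otimes> d = z \<otimes> (\<rho> ^^ c) d" using cond by simp
    have key: "(\<rho> ^^ i) z \<otimes> (\<rho> ^^ i) d = (\<rho> ^^ i) z \<otimes> (\<rho> ^^ (i + c)) d"
      using arg_cong[OF zd, of "\<rho> ^^ i"] z d_closed by (simp add: rho_pow_pow)
    have i'': "i = a + b - m" "\<not> a \<le> i" using False i' ab by auto
    show ?thesis
    proof (cases "i + c < m")
      case True
      then have k'': "k = i + c" using k' by simp
      have "(\<rho> ^^ a) (tw b ((b + c) mod m)) \<otimes> tw a k = (\<rho> ^^ k) d"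
      proof (cases "b + c < m")
        case bc: True
        then have "\<not> a \<le> k" using k'' i'' False ab by auto
        then show ?thesis unfolding tw using bc d_closed by (auto simp: tw_def)
      next
        case bc: False
        then have "a \<le> k" "a + (b + c - m) = k" using k'' i'' False ab by auto
        then show ?thesis unfolding tw using bc d_closed by (auto simp: tw_def)
      qed
      then show ?thesis using key k'' i'' d_closed by (simp add: tw_def)
    next
      case ic: False
      then have k'': "k = i + c - m" "k < i" using k' ab by auto
      have bc: "\<not> b + c < m" "\<not> a \<le> k" "a + (b + c - m) = i + c" "i + c = k + m"
        using ic k'' i'' False ab by auto
      have icd: "(\<rho> ^^ (i + c)) d = (\<rho> ^^ k) d"
        unfolding bc(4) by (rule rho_pow_add_period[OF d_closed])
      have "(\<rho> ^^ i) z \<otimes> ((\<rho> ^^ i) d \<otimes> (\<rho> ^^ k) d) = (\<rho> ^^ i) z \<otimes> ((\<rho> ^^ k) d \<otimes> (\<rho> ^^ k) d)"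
        using m_assoc[of "(\<rho> ^^ i) z" "(\<rho> ^^ i) d" "(\<rho> ^^ k) d"]
          m_assoc[of "(\<rho> ^^ i) z" "(\<rho> ^^ k) d" "(\<rho> ^^ k) d"] key d_closed z
        unfolding icd by simp
      then show ?thesis unfolding tw bc(3) icd
        using k''(2) i''(2) bc(1,2) by (simp add: tw_def)
    qed
  qed
qed

text \<open>
  Elements associate if any three of their monomials do, by the cocycle identity.
\<close>

lemma associates:
  assumes x: "x \<in> carrier A" and y: "y \<in> carrier A" and z: "z \<in> carrier A"
    and cond: "\<And>a b c. a < m \<Longrightarrow> b < m \<Longrightarrow> c < m \<Longrightarrow>
      x a = \<zero> \<or> y b = \<zero> \<or> z c = \<zero> \<or> a + b < m \<or> z c \<otimes> d = z c \<otimes> (\<rho> ^^ c) d"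
  shows "(x \<otimes>\<^bsub>A\<^esub> y) \<otimes>\<^bsub>A\<^esub> z = x \<otimes>\<^bsub>A\<^esub> (y \<otimes>\<^bsub>A\<^esub> z)"
proof (rule alg_eqI)
  show "(x \<otimes>\<^bsub>A\<^esub> y) \<otimes>\<^bsub>A\<^esub> z \<in> carrier A" "x \<otimes>\<^bsub>A\<^esub> (y \<otimes>\<^bsub>A\<^esub> z) \<in> carrier A"
    using x y z by auto
  fix k assume k: "k < m"
  let ?T = "\<lambda>i a. x a \<otimes> (\<rho> ^^ a) (y ((m + i - a) mod m)) \<otimes> tw a i \<otimes>
    (\<rho> ^^ i) (z ((m + k - i) mod m)) \<otimes> tw i k"
  let ?S = "\<lambda>a b. x a \<otimes> (\<rho> ^^ a) (y b \<otimes> (\<rho> ^^ b) (z ((m + (m + k - a) mod m - b) mod m))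
    \<otimes> tw b ((m + k - a) mod m)) \<otimes> tw a k"
  have Tc: "?T i a \<in> carrier K" for i a using x y z by auto
  have Sc: "?S a b \<in> carrier K" for a b using x y z by auto
  have "((x \<otimes>\<^bsub>A\<^esub> y) \<otimes>\<^bsub>A\<^esub> z) k = (\<Oplus>i\<in>{..<m}. \<Oplus>a\<in>{..<m}. ?T i a)"
  proof -
    have "(\<Oplus>a\<in>{..<m}. x a \<otimes> (\<rho> ^^ a) (y ((m + i - a) mod m)) \<otimes> tw a i)
        \<otimes> (\<rho> ^^ i) (z ((m + k - i) mod m)) \<otimes> tw i k = (\<Oplus>a\<in>{..<m}. ?T i a)" for i
      using x y z by (simp add: finsum_ldistr Pi_def)
    then have "(x \<otimes>\<^bsub>A\<^esub> y) i \<otimes> (\<rho> ^^ i) (z ((m + k - i) mod m)) \<otimes> tw i k = (\<Oplus>a\<in>{..<m}. ?T i a)"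
      if "i < m" for i
      using x y that by (simp add: mult_app[of x])
    then show ?thesis
      unfolding mult_app[OF alg_mult_closed[OF x y] z k]
      using Tc by (intro finsum_cong') (auto intro!: finsum_closed)
  qed
  also have "\<dots> = (\<Oplus>a\<in>{..<m}. \<Oplus>i\<in>{..<m}. ?T i a)"
    using Tc by (intro finsum_swap) auto
  also have "\<dots> = (\<Oplus>a\<in>{..<m}. \<Oplus>b\<in>{..<m}. ?S a b)"
  proof (rule finsum_cong')
    fix a assume "a \<in> {..<m}"
    then have a: "a < m" by simp
    let ?h = "\<lambda>b. (a + b) mod m"
    have inj: "inj_on ?h {..<m}"
    proof (rule inj_onI)
      fix b b' assume b: "b \<in> {..<m}" "b' \<in> {..<m}" and "?h b = ?h b'"
      then show "b = b'" using a b by (auto simp: mod_if split: if_splits)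
    qed
    have img: "?h ` {..<m} = {..<m}"
      using inj m_pos by (intro card_subset_eq) (auto simp: card_image)
    have "(\<Oplus>i\<in>{..<m}. ?T i a) = (\<Oplus>i\<in>?h ` {..<m}. ?T i a)" by (simp only: img)
    also have "\<dots> = (\<Oplus>b\<in>{..<m}. ?T (?h b) a)"
      using inj Tc by (intro finsum_reindex) auto
    also have "\<dots> = (\<Oplus>b\<in>{..<m}. ?S a b)"
    proof (rule finsum_cong')
      fix b assume "b \<in> {..<m}"
      then have b: "b < m" by simp
      define i where "i = ?h b"
      define c where "c = (m + k - i) mod m"
      have im: "i < m" and cm: "c < m" using m_pos by (simp_all add: i_def c_def)
      have mod: "u mod m = (if u < m then u else u - m)" if "u < 2 * m" for u
        using that by (auto simp: mod_if)
      have i': "i = (if a + b < m then a + b else a + b - m)" using i_def a b mod by simp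
      have ki: "k = (i + c) mod m"
        using im k by (simp add: c_def mod_simps)
      have e1: "(m + i - a) mod m = b"
        unfolding i_def by (rule mod_add_sub[OF a b])
      have bcm: "(b + c) mod m < m" using m_pos by simp
      have "k = (a + (b + c) mod m) mod m"
        unfolding ki i_def by (simp add: mod_simps add.assoc)
      then have ka: "(m + k - a) mod m = (b + c) mod m"
        using mod_add_sub[OF a bcm] by simp
      have e2: "(m + (b + c) mod m - b) mod m = c"
        by (rule mod_add_sub[OF b cm])
      have rz: "(\<rho> ^^ a) ((\<rho> ^^ b) (z c)) = (\<rho> ^^ i) (z c)"
        using i' rho_pow_add_period[of "z c" "a + b - m"] z by (auto simp: rho_pow_pow)
      let ?u = "x a \<otimes> (\<rho> ^^ a) (y b)"
      have uc: "?u \<in> carrier K" using x y by simp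
      have T: "?T i a = ?u \<otimes> ((\<rho> ^^ i) (z c) \<otimes> (tw a i \<otimes> tw i k))"
        unfolding e1 c_def[symmetric] using x y z by (simp add: m_ac)
      have S: "?S a b = ?u \<otimes> ((\<rho> ^^ i) (z c) \<otimes> ((\<rho> ^^ a) (tw b ((b + c) mod m)) \<otimes> tw a k))"
        unfolding ka e2 using x y z rz by (simp add: m_ac)
      from cond[OF a b cm] have "?T i a = ?S a b"
      proof (elim disjE)
        assume "a + b < m"
        then show ?thesis unfolding T S using cocycle[OF a b cm i_def ki] z by simp
      next
        assume "z c \<otimes> d = z c \<otimes> (\<rho> ^^ c) d"
        then show ?thesis unfolding T S using cocycle[OF a b cm i_def ki] z by simp
      qed (unfold T S, use x y z in simp_all)
      then show "?T (?h b) a = ?S a b" unfolding i_def .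
    qed (use Sc in auto)
    finally show "(\<Oplus>i\<in>{..<m}. ?T i a) = (\<Oplus>b\<in>{..<m}. ?S a b)" .
  qed (use Sc in \<open>auto intro!: finsum_closed\<close>)
  also have "\<dots> = (x \<otimes>\<^bsub>A\<^esub> (y \<otimes>\<^bsub>A\<^esub> z)) k"
  proof -
    have *: "(\<Oplus>b\<in>{..<m}. ?S a b) =
      x a \<otimes> (\<rho> ^^ a) ((y \<otimes>\<^bsub>A\<^esub> z) ((m + k - a) mod m)) \<otimes> tw a k" for a
      using x y z m_pos
      by (simp add: mult_app[of y] rho_pow_finsum finsum_ldistr finsum_rdistr Pi_def)
    show ?thesis using x y z k by (simp only: * mult_app alg_mult_closed)
  qed
  finally show "((x \<otimes>\<^bsub>A\<^esub> y) \<otimes>\<^bsub>A\<^esub> z) k = (x \<otimes>\<^bsub>A\<^esub> (y \<otimes>\<^bsub>A\<^esub> z)) k" .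
qed

end

section \<open>Nuclei, centre and dimension\<close>

context cyclic_petit
begin

lemma mon_app: "mon a i j = (if j = i then a else \<zero>)"
  by (simp add: mon_def)

text \<open>The condition comes from the associator of \<open>t\<^sup>m\<^sup>-\<^sup>1\<close>, \<open>t\<close> and \<open>z\<close>.\<close>

lemma nuc_r_coeff:
  assumes z: "z \<in> nuc_r A" and c: "c < m"
  shows "z c \<otimes> d = z c \<otimes> (\<rho> ^^ c) d"
proof (cases "m = 1")
  case True
  then show ?thesis using c by simp
next
  case False
  then have m2: "1 < m" using m_pos by simp
  have zA: "z \<in> carrier A" using z by (simp add: nuc_r_def)
  have zc: "z i \<in> carrier K" for i using zA by simp
  define x where "x = mon \<one> (m - 1)"
  define y where "y = mon \<one> 1"
  have xA: "x \<in> carrier A" and yA: "y \<in> carrier A" using m2 by (auto simp: x_def y_def)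
  have xy: "x \<otimes>\<^bsub>A\<^esub> y = mon d 0"
  proof (rule alg_eqI)
    show "x \<otimes>\<^bsub>A\<^esub> y \<in> carrier A" using xA yA by simp
    show "mon d 0 \<in> carrier A" using d_closed m_pos by simp
    fix k assume k: "k < m"
    have "(x \<otimes>\<^bsub>A\<^esub> y) k = \<one> \<otimes> (\<rho> ^^ (m - 1)) (y ((m + k - (m - 1)) mod m)) \<otimes> tw (m - 1) k"
      unfolding x_def using m2 k yA by (intro mon_mult_app) auto
    moreover have "m + k - (m - 1) = k + 1" using m2 by simp
    ultimately show "(x \<otimes>\<^bsub>A\<^esub> y) k = mon d 0 k"
      using m2 k d_closed by (cases "k = m - 1") (auto simp: y_def mon_app tw_def)
  qed
  define j where "j = (c + 1) mod m"
  have jm: "j < m" using m_pos by (simp add: j_def)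
  have "(m + j - 1) mod m = c"
    using mod_add_sub[OF m2 c] by (simp add: j_def)
  then have yz: "(y \<otimes>\<^bsub>A\<^esub> z) j = \<rho> (z c) \<otimes> tw 1 j"
    unfolding y_def using mon_mult_app[OF one_closed m2 zA jm] zc rho_pow_closed[of "z c" 1] by simp
  have "z c \<otimes> d = ((x \<otimes>\<^bsub>A\<^esub> y) \<otimes>\<^bsub>A\<^esub> z) c"
    unfolding xy using mon_mult_app[OF d_closed m_pos zA c] c zc d_closed by (simp add: tw_def m_comm)
  also have "\<dots> = (x \<otimes>\<^bsub>A\<^esub> (y \<otimes>\<^bsub>A\<^esub> z)) c"
    using z xA yA zA associator_zero_iff by (auto simp: nuc_r_def)
  also have "\<dots> = (\<rho> ^^ (m - 1)) ((y \<otimes>\<^bsub>A\<^esub> z) j) \<otimes> tw (m - 1) c"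
  proof -
    have "m + c - (m - 1) = c + 1" using m2 by simp
    then have "(m + c - (m - 1)) mod m = j" by (simp add: j_def)
    then show ?thesis
      unfolding x_def using mon_mult_app[of \<one> "m - 1" "y \<otimes>\<^bsub>A\<^esub> z" c] m2 c yA zA by simp
  qed
  also have "\<dots> = z c \<otimes> (\<rho> ^^ c) d"
  proof -
    have p: "(\<rho> ^^ (m - 1)) (\<rho> (z c)) = z c"
    proof -
      have "(\<rho> ^^ (m - 1)) (\<rho> (z c)) = (\<rho> ^^ (m - 1)) ((\<rho> ^^ 1) (z c))" by simp
      also have "\<dots> = (\<rho> ^^ (m - 1 + 1)) (z c)" by (rule rho_pow_pow)
      finally show ?thesis using m2 rho_period[OF zc] by simp
    qed
    have rc: "\<rho> (z c) \<in> carrier K" using rho_pow_closed[OF zc, of 1] by simp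
    show ?thesis
    proof (cases "c = m - 1")
      case True
      then have "j = 0" using m2 by (simp add: j_def)
      then show ?thesis unfolding yz using p rc zc d_closed True by (simp add: tw_def)
    next
      case False
      then have "j = c + 1" "c < m - 1" using c by (simp_all add: j_def)
      then show ?thesis unfolding yz using p rc zc d_closed by (simp add: tw_def)
    qed
  qed
  finally show ?thesis .
qed

theorem nuc_r_eq: "nuc_r A = {z \<in> carrier A. \<forall>c<m. z c \<otimes> d = z c \<otimes> (\<rho> ^^ c) d}"
proof
  show "nuc_r A \<subseteq> {z \<in> carrier A. \<forall>c<m. z c \<otimes> d = z c \<otimes> (\<rho> ^^ c) d}"
    using nuc_r_coeff by (auto simp: nuc_r_def)
  show "{z \<in> carrier A. \<forall>c<m. z c \<otimes> d = z c \<otimes> (\<rho> ^^ c) d} \<subseteq> nuc_r A"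
    by (auto simp: nuc_r_def associator_zero_iff intro!: associates)
qed

lemma rho_fixed_pow: "\<rho> d = d \<Longrightarrow> (\<rho> ^^ i) d = d"
  by (induct i) auto

lemma associative_if_fixed: "\<rho> d = d \<Longrightarrow> associative_alg A"
  by (auto simp: associative_alg_def associator_zero_iff rho_fixed_pow intro!: associates)

lemma fixed_if_associative:
  assumes "associative_alg A"
  shows "\<rho> d = d"
proof (cases "m = 1")
  case True
  then show ?thesis using rho_period[OF d_closed] by simp
next
  case False
  then have m2: "1 < m" using m_pos by simp
  then have "mon \<one> 1 \<in> nuc_r A"
    using assms by (auto simp: associative_alg_def nuc_r_def)
  then show ?thesis using nuc_r_coeff[of "mon \<one> 1" 1] m2 d_closed rho_pow_closed[OF d_closed, of 1]
    by (simp add: mon_app)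
qed

lemma const_in_alg: "a \<in> carrier K \<Longrightarrow> const_poly K a \<in> carrier A"
  by (simp add: const_poly_mon m_pos)

lemma const_app: "a \<in> carrier K \<Longrightarrow> const_poly K a i = (if i = 0 then a else \<zero>)"
  by (simp add: const_poly_mon mon_app)

lemma const_in_nuc: "a \<in> carrier K \<Longrightarrow> const_poly K a \<in> nuc A"
  unfolding nuc_def nuc_l_def nuc_m_def nuc_r_def
  by (auto simp: const_in_alg associator_zero_iff const_app intro!: associates split: if_splits)

text \<open>The condition comes from the associator of \<open>x\<close>, \<open>t\<^sup>m\<^sup>-\<^sup>a\<close> and \<open>t\<close>.\<close>

lemma nuc_l_coeff:
  assumes x: "x \<in> nuc_l A" and a: "0 < a" "a < m"
  shows "x a \<otimes> d = x a \<otimes> \<rho> d"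
proof -
  have m2: "1 < m" and am: "m - a < m" using a by auto
  have xA: "x \<in> carrier A" using x by (simp add: nuc_l_def)
  have xc: "x i \<in> carrier K" for i using xA by simp
  have rd: "\<rho> d \<in> carrier K" using rho_pow_closed[OF d_closed, of 1] by simp
  define y where "y = mon \<one> (m - a)"
  define z where "z = mon \<one> 1"
  have yA: "y \<in> carrier A" and zA: "z \<in> carrier A" using m2 a by (auto simp: y_def z_def)
  have "(x \<otimes>\<^bsub>A\<^esub> y) 0 = x a \<otimes> (\<rho> ^^ a) \<one> \<otimes> tw a 0"
    unfolding y_def using xA a by (intro mult_mon_app) auto
  then have xy: "(x \<otimes>\<^bsub>A\<^esub> y) 0 = x a \<otimes> d"
    using a xc by (simp add: tw_def)
  have "x a \<otimes> d = ((x \<otimes>\<^bsub>A\<^esub> y) \<otimes>\<^bsub>A\<^esub> z) 1"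
  proof -
    have "((x \<otimes>\<^bsub>A\<^esub> y) \<otimes>\<^bsub>A\<^esub> z) 1 = (x \<otimes>\<^bsub>A\<^esub> y) 0 \<otimes> (\<rho> ^^ 0) \<one> \<otimes> tw 0 1"
      unfolding z_def using xA yA m2 by (intro mult_mon_app) auto
    then show ?thesis using xy xc d_closed by (simp add: tw_def)
  qed
  also have "\<dots> = (x \<otimes>\<^bsub>A\<^esub> (y \<otimes>\<^bsub>A\<^esub> z)) 1"
    using x xA yA zA associator_zero_iff by (auto simp: nuc_l_def)
  also have "\<dots> = x a \<otimes> \<rho> d"
  proof (cases "a = 1")
    case True
    have "y \<otimes>\<^bsub>A\<^esub> z = mon d 0"
    proof (rule alg_eqI)
      fix k assume k: "k < m"
      have "(y \<otimes>\<^bsub>A\<^esub> z) k = \<one> \<otimes> (\<rho> ^^ (m - 1)) (z ((m + k - (m - 1)) mod m)) \<otimes> tw (m - 1) k"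
        unfolding y_def True using m2 k zA by (intro mon_mult_app) auto
      moreover have "m + k - (m - 1) = k + 1" using m2 by simp
      ultimately show "(y \<otimes>\<^bsub>A\<^esub> z) k = mon d 0 k"
        using m2 k d_closed by (cases "k = m - 1") (auto simp: z_def mon_app tw_def)
    qed (use yA zA d_closed m_pos in auto)
    moreover have "(x \<otimes>\<^bsub>A\<^esub> mon d 0) 1 = x 1 \<otimes> (\<rho> ^^ 1) d \<otimes> tw 1 1"
      using xA m2 d_closed mod_diff[of 0 1] by (intro mult_mon_app) auto
    ultimately show ?thesis using True xc rd by (simp add: tw_def)
  next
    case False
    have "y \<otimes>\<^bsub>A\<^esub> z = mon \<one> (m - a + 1)"
    proof (rule alg_eqI)
      fix k assume k: "k < m"
      have "(y \<otimes>\<^bsub>A\<^esub> z) k = \<one> \<otimes> (\<rho> ^^ (m - a)) (z ((m + k - (m - a)) mod m)) \<otimes> tw (m - a) k"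
        unfolding y_def using am k zA by (intro mon_mult_app) auto
      moreover have "(m + k - (m - a)) mod m = 1 \<longleftrightarrow> k = m - a + 1"
        unfolding mod_diff[OF am k] using a k False by auto
      ultimately show "(y \<otimes>\<^bsub>A\<^esub> z) k = mon \<one> (m - a + 1) k"
        using m2 k d_closed by (auto simp: z_def mon_app tw_def)
    qed (use yA zA False a m_pos in auto)
    moreover have "(x \<otimes>\<^bsub>A\<^esub> mon \<one> (m - a + 1)) 1 = x a \<otimes> (\<rho> ^^ a) \<one> \<otimes> tw a 1"
      using xA m2 a False by (intro mult_mon_app) auto
    ultimately show ?thesis using a False xc rd by (simp add: tw_def)
  qed
  finally show ?thesis .
qed

lemma const_imageI:
  assumes "x \<in> carrier A" and "\<And>c. 0 < c \<Longrightarrow> c < m \<Longrightarrow> x c = \<zero>" "x 0 \<in> E" "E \<subseteq> carrier K"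
  shows "x \<in> const_poly K ` E"
proof
  show "x = const_poly K (x 0)"
    using assms const_in_alg[of "x 0"] by (intro alg_eqI) (auto simp: const_app)
qed (rule assms)

lemma const_mult_app:
  "a \<in> carrier K \<Longrightarrow> x \<in> carrier A \<Longrightarrow> k < m \<Longrightarrow> (const_poly K a \<otimes>\<^bsub>A\<^esub> x) k = a \<otimes> x k"
  using mon_mult_app[of a 0 x k] m_pos by (simp add: const_poly_mon tw_def)

lemma mult_const_app:
  "a \<in> carrier K \<Longrightarrow> x \<in> carrier A \<Longrightarrow> k < m \<Longrightarrow>
    (x \<otimes>\<^bsub>A\<^esub> const_poly K a) k = x k \<otimes> (\<rho> ^^ k) a"
  using mult_mon_app[of a 0 x k k] m_pos by (simp add: const_poly_mon tw_def)

text \<open>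
  Commuting with \<open>K\<close> leaves, under the separation hypothesis, only constants; commuting with \<open>t\<close>
  makes the constant fixed by \<open>\<rho>\<close>.
\<close>

lemma center_eq:
  assumes fixed: "\<rho> d = d"
    and sep: "\<And>c z. 0 < c \<Longrightarrow> c < m \<Longrightarrow> z \<in> carrier K \<Longrightarrow>
      (\<And>y. y \<in> carrier K \<Longrightarrow> y \<otimes> z = z \<otimes> (\<rho> ^^ c) y) \<Longrightarrow> z = \<zero>"
  shows "alg_center A = const_poly K ` {x \<in> carrier K. \<rho> x = x}"
proof
  show "alg_center A \<subseteq> const_poly K ` {x \<in> carrier K. \<rho> x = x}"
  proof
    fix x assume x: "x \<in> alg_center A"
    then have xA: "x \<in> carrier A" and comm: "\<And>y. y \<in> carrier A \<Longrightarrow> x \<otimes>\<^bsub>A\<^esub> y = y \<otimes>\<^bsub>A\<^esub> x"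
      by (auto simp: alg_center_def nuc_def nuc_l_def)
    show "x \<in> const_poly K ` {x \<in> carrier K. \<rho> x = x}"
    proof (rule const_imageI[OF xA])
      fix c assume c: "0 < c" "c < m"
      show "x c = \<zero>"
      proof (rule sep[OF c])
        fix y assume y: "y \<in> carrier K"
        show "y \<otimes> x c = x c \<otimes> (\<rho> ^^ c) y"
          using comm[OF const_in_alg[OF y]] const_mult_app[OF y xA c(2)] mult_const_app[OF y xA c(2)]
          by simp
      qed (use xA in simp)
    next
      have "\<rho> (x 0) = x 0"
      proof (cases "m = 1")
        case True
        then show ?thesis using rho_period[of "x 0"] xA by simp
      next
        case False
        then have m2: "1 < m" using m_pos by simp
        have r: "\<rho> (x 0) \<in> carrier K" using rho_pow_closed[of "x 0" 1] xA by simp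
        have "(mon \<one> 1 \<otimes>\<^bsub>A\<^esub> x) 1 = \<one> \<otimes> (\<rho> ^^ 1) (x ((m + 1 - 1) mod m)) \<otimes> tw 1 1"
          using m2 xA by (intro mon_mult_app) auto
        moreover have "(x \<otimes>\<^bsub>A\<^esub> mon \<one> 1) 1 = x 0 \<otimes> (\<rho> ^^ 0) \<one> \<otimes> tw 0 1"
          using m2 xA by (intro mult_mon_app) auto
        ultimately show ?thesis
          using comm[of "mon \<one> 1"] m2 xA r by (simp add: tw_def)
      qed
      then show "x 0 \<in> {x \<in> carrier K. \<rho> x = x}" using xA by simp
    qed auto
  qed
  show "const_poly K ` {x \<in> carrier K. \<rho> x = x} \<subseteq> alg_center A"
  proof clarify
    fix e assume e: "e \<in> carrier K" "\<rho> e = e"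
    have ep: "(\<rho> ^^ k) e = e" for k using e(2) by (induct k) auto
    have "const_poly K e \<otimes>\<^bsub>A\<^esub> y = y \<otimes>\<^bsub>A\<^esub> const_poly K e" if "y \<in> carrier A" for y
      using that e const_in_alg[OF e(1)] ep
      by (intro alg_eqI) (auto simp: const_mult_app mult_const_app m_comm)
    then show "const_poly K e \<in> alg_center A"
      using const_in_nuc[OF e(1)] by (simp add: alg_center_def)
  qed
qed

text \<open>
  When \<open>d\<close> is fixed by \<open>\<rho>\<close>, the algebra is a ring containing \<open>K\<close>, and the powers
  \<open>1, t, \<dots>, t\<^sup>m\<^sup>-\<^sup>1\<close> form a left \<open>K\<close>-basis.
\<close>

lemma const_ring_hom:
  assumes "\<rho> d = d"
  shows "ring_hom_ring K A (const_poly K)"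
proof (rule ring_hom_ringI[OF ring_axioms ring_if_associative[OF associative_if_fixed[OF assms]]])
  fix a b assume ab: "a \<in> carrier K" "b \<in> carrier K"
  show "const_poly K (a \<otimes> b) = const_poly K a \<otimes>\<^bsub>A\<^esub> const_poly K b"
    using ab const_in_alg
    by (intro alg_eqI) (auto simp: const_mult_app, auto simp: const_poly_mon mon_app)
  show "const_poly K (a \<oplus> b) = const_poly K a \<oplus>\<^bsub>A\<^esub> const_poly K b"
    using ab const_in_alg
    by (intro alg_eqI) (auto simp: add_app, auto simp: const_poly_mon mon_app)
qed (auto simp: const_in_alg, auto simp: const_poly_mon one_mon)

lemma const_inj: "inj_on (const_poly K) (carrier K)"
proof (rule inj_onI)
  fix a b assume "a \<in> carrier K" "b \<in> carrier K" "const_poly K a = const_poly K b"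
  then show "a = b" by (metis const_app)
qed

lemma dimension_over_const:
  assumes fixed: "\<rho> d = d"
  shows "ring.dimension A m (const_poly K ` carrier K) (carrier A)"
proof -
  interpret R: ring A by (rule ring_if_associative[OF associative_if_fixed[OF fixed]])
  have "R.dimension j (const_poly K ` carrier K) {x \<in> carrier A. \<forall>i\<ge>j. x i = \<zero>}" if "j \<le> m" for j
    using that
  proof (induct j)
    case 0
    have "{x \<in> carrier A. \<forall>i\<ge>0. x i = \<zero>} = {\<zero>\<^bsub>A\<^esub>}"
      by (auto simp: zero_alg intro: alg_memI)
    then show ?case by simp
  next
    case (Suc j)
    then have j: "j < m" by simp
    let ?E = "{x \<in> carrier A. \<forall>i\<ge>j. x i = \<zero>}"
    have "mon \<one> j \<notin> ?E" using nontriv by (auto simp: mon_app)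
    then have "R.dimension (Suc j) (const_poly K ` carrier K)
        (R.line_extension (const_poly K ` carrier K) (mon \<one> j) ?E)"
      using Suc j by (intro R.Suc_dim) auto
    moreover have "R.line_extension (const_poly K ` carrier K) (mon \<one> j) ?E =
      {x \<in> carrier A. \<forall>i\<ge>Suc j. x i = \<zero>}" (is "?L = ?R")
    proof -
      have cm: "const_poly K a \<otimes>\<^bsub>A\<^esub> mon \<one> j = mon a j" if "a \<in> carrier K" for a
        using that j const_in_alg by (intro alg_eqI) (auto simp: const_mult_app mon_app)
      have L: "?L = {mon a j \<oplus>\<^bsub>A\<^esub> x | a x. a \<in> carrier K \<and> x \<in> ?E}"
        unfolding R.line_extension_def set_add_def' r_coset_def using cm by fastforce
      show ?thesis
      proof
        show "?L \<subseteq> ?R"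
        proof
          fix u assume "u \<in> ?L"
          then obtain a x where a: "a \<in> carrier K" and x: "x \<in> ?E" and u: "u = mon a j \<oplus>\<^bsub>A\<^esub> x"
            unfolding L by blast
          have ma: "mon a j \<in> carrier A" using a j by simp
          have "u i = \<zero>" if "Suc j \<le> i" for i
            using x that unfolding u by (simp add: add_app[OF ma]) (simp add: mon_app)
          moreover have "u \<in> carrier A" unfolding u using ma x by simp
          ultimately show "u \<in> ?R" by simp
        qed
        show "?R \<subseteq> ?L"
        proof
          fix x assume x: "x \<in> ?R"
          then have xA: "x \<in> carrier A" by simp
          have x0: "x(j := \<zero>) \<in> carrier A"
            using alg_closed[OF xA] alg_above[OF xA] by (intro alg_memI) simp_all
          moreover have "x = mon (x j) j \<oplus>\<^bsub>A\<^esub> x(j := \<zero>)"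
          proof
            fix i
            have "(mon (x j) j \<oplus>\<^bsub>A\<^esub> x(j := \<zero>)) i = mon (x j) j i \<oplus> (x(j := \<zero>)) i"
              using xA j x0 by (intro add_app) auto
            then show "x i = (mon (x j) j \<oplus>\<^bsub>A\<^esub> x(j := \<zero>)) i"
              using alg_closed[OF xA] by (simp add: mon_app)
          qed
          moreover have "x j \<in> carrier K" using xA by simp
          moreover have "\<forall>i\<ge>j. (x(j := \<zero>)) i = \<zero>" using x by auto
          ultimately show "x \<in> ?L" unfolding L using x by blast
        qed
      qed
    qed
    ultimately show ?case by simp
  qed
  then have "R.dimension m (const_poly K ` carrier K) {x \<in> carrier A. \<forall>i\<ge>m. x i = \<zero>}"
    by simp
  moreover have "{x \<in> carrier A. \<forall>i\<ge>m. x i = \<zero>} = carrier A" by auto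
  ultimately show ?thesis by simp
qed

lemma dimension_over_const_subfield:
  assumes fld: "field K" and fixed: "\<rho> d = d" and E: "subfield E K" and dim: "dimension r E (carrier K)"
  shows "ring.dimension A (r * m) (const_poly K ` E) (carrier A)"
proof -
  interpret h: ring_hom_ring K A "const_poly K" by (rule const_ring_hom[OF fixed])
  have one: "\<one>\<^bsub>A\<^esub> \<noteq> \<zero>\<^bsub>A\<^esub>"
    using nontriv by (auto simp: one_alg zero_alg dest: fun_cong[of _ _ 0])
  show ?thesis
  proof (rule h.S.telescopic_base)
    show "subfield (const_poly K ` E) A" by (rule h.img_is_subfield(2)[OF E one])
    show "subfield (const_poly K ` carrier K) A"
      by (rule h.img_is_subfield(2)[OF field.carrier_is_subfield[OF fld] one])
    show "h.S.dimension r (const_poly K ` E) (const_poly K ` carrier K)"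
      by (rule h.inj_hom_dimension[OF E one const_inj dim])
    show "h.S.dimension m (const_poly K ` carrier K) (carrier A)"
      by (rule dimension_over_const[OF fixed])
  qed
qed

end

section \<open>Degrees over fixed fields of a cyclic group\<close>

lemma (in ring) ring_hom_funpow:
  assumes "\<tau> \<in> ring_hom R R"
  shows "\<tau> ^^ i \<in> ring_hom R R"
proof (induct i)
  case 0
  then show ?case by (simp add: ring_hom_def)
next
  case (Suc i)
  then show ?case using ring_hom_trans[OF Suc assms] by (simp only: funpow.simps)
qed

lemma (in field) fixed_subfield:
  assumes "\<tau> \<in> ring_hom R R"
  shows "subfield {x \<in> carrier R. \<tau> x = x} R"
proof -
  interpret h: ring_hom_ring R R \<tau>
    by (rule ring_hom_ringI2[OF ring_axioms ring_axioms assms])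
  show ?thesis
  proof (rule subfieldI')
    show "subring {x \<in> carrier R. \<tau> x = x} R" by (rule subringI) auto
    fix k assume k: "k \<in> {x \<in> carrier R. \<tau> x = x} - {\<zero>}"
    then have kU: "k \<in> Units R" by (simp add: field_Units)
    then have "\<tau> (inv k) \<otimes> k = \<one>"
      using h.hom_mult[of "inv k" k] k by simp
    then have "\<tau> (inv k) = inv k"
      using inv_char[of k "\<tau> (inv k)"] kU k by (metis (no_types, lifting) Diff_iff Units_inv_closed h.hom_closed m_comm mem_Collect_eq)
    then show "inv k \<in> {x \<in> carrier R. \<tau> x = x}" using kU by simp
  qed
qed

text \<open>
  Artin's inequality: elements with at most \<open>r\<close> conjugates under \<open>\<tau>\<close> span at most \<open>r\<close> dimensions
  over the fixed field. The vectors of conjugates are independent over the whole field, since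
  applying \<open>\<tau>\<close> to a linear relation permutes the equations, so that uniqueness forces the
  coefficients to be fixed. These vectors live in an \<open>r\<close>-dimensional space; for this the algebra
  \<open>R[t]/(t\<^sup>r - 1)\<close> is used, of which only the linear structure matters.
\<close>

lemma (in field) artin_inequality:
  assumes hom: "\<tau> \<in> ring_hom R R" and F: "F = {x \<in> carrier R. \<tau> x = x}" and r: "0 < r"
    and indep: "independent F Us" and period: "\<And>u. u \<in> set Us \<Longrightarrow> (\<tau> ^^ r) u = u"
  shows "length Us \<le> r"
proof -
  have sF: "subfield F R" unfolding F by (rule fixed_subfield[OF hom])
  interpret h: ring_hom_ring R R \<tau>
    by (rule ring_hom_ringI2[OF ring_axioms ring_axioms hom])
  interpret C: cyclic_petit R "\<lambda>x. x" r \<one>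
    by unfold_locales (auto simp: ring_hom_def id_def[symmetric] r)
  interpret B: ring C.A by (rule C.ring_if_associative[OF C.associative_if_fixed]) simp
  interpret c: ring_hom_ring R C.A "const_poly R" by (rule C.const_ring_hom) simp
  let ?L = "const_poly R ` carrier R"
  have one: "\<one>\<^bsub>C.A\<^esub> \<noteq> \<zero>\<^bsub>C.A\<^esub>"
    by (auto simp: C.one_alg C.zero_alg dest: fun_cong[of _ _ 0])
  have sL: "subfield ?L C.A" by (rule c.img_is_subfield(2)[OF carrier_is_subfield one])
  define w where "w u = (\<lambda>i. if i < r then (\<tau> ^^ i) u else \<zero>)" for u
  have pc: "(\<tau> ^^ i) u \<in> carrier R" if "u \<in> carrier R" for i u
    using that by (induct i) auto
  have wc: "w u \<in> carrier C.A" if "u \<in> carrier R" for u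
    using that pc unfolding w_def by (intro C.alg_memI) auto
  have wcs: "set (map w Vs) \<subseteq> carrier C.A" if "set Vs \<subseteq> carrier R" for Vs
    using that wc by auto
  have comb: "B.combine (map (const_poly R) as) (map w Vs) i = combine as (map (\<tau> ^^ i) Vs)"
    if "set as \<subseteq> carrier R" "set Vs \<subseteq> carrier R" "i < r" for as Vs i
    using that
  proof (induct as Vs rule: list_induct2')
    case (4 a as v Vs)
    have "B.combine (map (const_poly R) as) (map w Vs) \<in> carrier C.A"
      using 4 wc by (intro B.combine_in_carrier) (auto simp: C.const_in_alg)
    then show ?case
      using 4 wc[of v] C.const_in_alg[of a]
      by (simp add: C.add_app C.const_mult_app) (simp add: w_def)
  qed (auto simp: C.zero_alg)
  have comb_hom: "\<tau> (combine as (map (\<tau> ^^ i) Vs)) = combine (map \<tau> as) (map (\<tau> ^^ Suc i) Vs)"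
    if "set as \<subseteq> carrier R" "set Vs \<subseteq> carrier R" for as Vs i
  proof -
    have "set (map (\<tau> ^^ i) Vs) \<subseteq> carrier R" using that(2) pc by auto
    then show ?thesis using h.combine_hom[OF that(1), of "map (\<tau> ^^ i) Vs"] by (simp add: comp_def)
  qed
  have "B.independent ?L (map w Us)"
    using indep period
  proof (induct Us rule: list.induct)
    case (Cons u Us)
    have uc: "u \<in> carrier R" and nu: "u \<notin> Span F Us" and Us: "independent F Us"
      using independent_backwards[OF Cons(2)] by auto
    have Uc: "set Us \<subseteq> carrier R" by (rule independent_in_carrier[OF Us])
    have IH: "B.independent ?L (map w Us)" using Cons Us by auto
    have "w u \<notin> B.Span ?L (map w Us)"
    proof
      assume mem: "w u \<in> B.Span ?L (map w Us)"
      then obtain Ks where Ks: "set Ks \<subseteq> ?L" "length Ks = length Us"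
        "w u = B.combine Ks (map w Us)"
        unfolding B.Span_eq_combine_set_length_version[OF sL wcs[OF Uc]] by auto
      define as where "as = map (inv_into (carrier R) (const_poly R)) Ks"
      have as: "set as \<subseteq> carrier R" "Ks = map (const_poly R) as"
        using Ks(1) by (auto simp: as_def f_inv_into_f subset_iff intro: inv_into_into
          intro!: map_idI[symmetric])
      have eq: "(\<tau> ^^ i) u = combine as (map (\<tau> ^^ i) Us)" if "i < r" for i
        using comb[OF as(1) Uc that] fun_cong[OF Ks(3), of i] that as(2) by (simp add: w_def)
      \<comment> \<open>Applying \<open>\<tau>\<close> shifts the equations cyclically, as \<open>\<tau>\<^sup>r\<close> fixes all the elements involved.\<close>
      have eq': "(\<tau> ^^ i) u = combine (map \<tau> as) (map (\<tau> ^^ i) Us)" if "i < r" for i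
      proof (cases i)
        case 0
        have "(\<tau> ^^ Suc (r - 1)) u = combine (map \<tau> as) (map (\<tau> ^^ Suc (r - 1)) Us)"
          using eq[of "r - 1"] r unfolding comb_hom[OF as(1) Uc, symmetric]
          by (simp only: funpow.simps comp_apply)
        moreover have "map (\<tau> ^^ r) Us = map (\<tau> ^^ 0) Us"
          using Cons(3) by (intro map_cong) auto
        ultimately show ?thesis using r Cons(3)[of u] 0 by simp
      next
        case (Suc j)
        then show ?thesis using comb_hom[OF as(1) Uc, of j] eq[of j] that by simp
      qed
      have ta: "set (map \<tau> as) \<subseteq> carrier R" using as(1) by auto
      have "w u = B.combine (map (const_poly R) (map \<tau> as)) (map w Us)"
      proof (rule C.alg_eqI[OF wc[OF uc]])
        show "B.combine (map (const_poly R) (map \<tau> as)) (map w Us) \<in> carrier C.A"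
          using wcs[OF Uc] ta by (intro B.combine_in_carrier) (auto simp: C.const_in_alg)
        show "w u k = B.combine (map (const_poly R) (map \<tau> as)) (map w Us) k" if "k < r" for k
          using comb[OF ta Uc that] eq'[OF that] that by (simp add: w_def)
      qed
      moreover have "set (map (const_poly R) (map \<tau> as)) \<subseteq> ?L" using ta by auto
      moreover have "length (map (const_poly R) (map \<tau> as)) = length (map w Us)"
        using Ks(2) as(2) by simp
      ultimately have "Ks = map (const_poly R) (map \<tau> as)"
        using B.unique_decomposition[OF sL IH mem] Ks by auto
      then have "map (const_poly R) as = map (const_poly R) (map \<tau> as)" using as(2) by simp
      then have "as = map \<tau> as"
        using map_inj_on[of "const_poly R" as "map \<tau> as"] C.const_inj as(1) ta
        by (metis inj_on_subset Un_least)
      then have "set as \<subseteq> F"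
        using as(1) unfolding F by (auto simp: list_eq_iff_nth_eq in_set_conv_nth)
      moreover have "u = combine as Us" using eq[of 0] r by simp
      ultimately show False
        using nu Span_eq_combine_set[OF sF Uc] by blast
    qed
    then show ?case using B.li_Cons[OF wc[OF uc] _ IH] by simp
  qed simp
  moreover have "set (map w Us) \<subseteq> carrier C.A"
    by (rule wcs[OF independent_in_carrier[OF indep]])
  ultimately have "length (map w Us) \<le> r"
    by (rule B.independent_length_le_dimension[OF sL C.dimension_over_const[OF refl]])
  then show ?thesis by simp
qed

text \<open>A maximal independent list is a basis.\<close>

lemma (in ring) dimension_if_bounded:
  assumes E: "subfield E R"
    and bound: "\<And>Us. independent E Us \<Longrightarrow> length Us \<le> b"
  obtains k where "k \<le> b" "dimension k E (carrier R)"
proof -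
  define S where "S = {length Us | Us. independent E Us}"
  have S: "finite S" "S \<noteq> {}"
    unfolding S_def using bound by (auto intro: finite_subset[of _ "{..b}"] li_Nil)
  then have "Max S \<in> S" by simp
  then obtain Us where Us: "length Us = Max S" "independent E Us" unfolding S_def by auto
  have Uc: "set Us \<subseteq> carrier R" by (rule independent_in_carrier[OF Us(2)])
  have "carrier R \<subseteq> Span E Us"
  proof
    fix v assume v: "v \<in> carrier R"
    show "v \<in> Span E Us"
    proof (rule ccontr)
      assume "v \<notin> Span E Us"
      then have "independent E (v # Us)" by (intro li_Cons v Us(2))
      then have "Suc (Max S) \<in> S" using Us(1) unfolding S_def by (metis (mono_tags, lifting) length_Cons mem_Collect_eq)
      then show False using Max_ge[OF S(1)] by fastforce
    qed
  qed
  then have "Span E Us = carrier R"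
    using Span_in_carrier[OF subfieldE(3)[OF E] Uc] by auto
  then show ?thesis using dimensionI[OF E Us(2)] bound[OF Us(2)] that by blast
qed

lemma (in field) cyclic_tower:
  assumes hom: "\<tau> \<in> ring_hom R R" and n: "n = s * r" "0 < s" "0 < r"
    and period: "\<And>x. x \<in> carrier R \<Longrightarrow> (\<tau> ^^ n) x = x"
    and F: "F = {x \<in> carrier R. \<tau> x = x}" and E: "E = {x \<in> carrier R. (\<tau> ^^ s) x = x}"
    and dim: "dimension n F (carrier R)"
  shows "subfield E R" and "dimension r E (carrier R)" and "dimension s F E"
proof -
  note hom_s = ring_hom_funpow[OF hom]
  have sF: "subfield F R" unfolding F by (rule fixed_subfield[OF hom])
  show sE: "subfield E R" unfolding E by (rule fixed_subfield[OF hom_s])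
  have "length Us \<le> r" if "independent E Us" for Us
  proof (rule artin_inequality[OF hom_s E n(3) that])
    fix u assume "u \<in> set Us"
    then have "u \<in> carrier R" using independent_in_carrier[OF that] by auto
    then show "((\<tau> ^^ s) ^^ r) u = u" using period n(1) by (simp add: funpow_mult)
  qed
  then obtain k where k: "k \<le> r" "dimension k E (carrier R)"
    by (rule dimension_if_bounded[OF sE])
  have FE: "F \<subseteq> E"
  proof
    fix x assume "x \<in> F"
    then have x: "x \<in> carrier R" "\<tau> x = x" by (auto simp: F)
    then have "(\<tau> ^^ s) x = x" by (induct s) auto
    then show "x \<in> E" using x E by simp
  qed
  have "subalgebra F E R"
  proof -
    have "subgroup E (add_monoid R)"
      using subring.axioms(1)[OF subfieldE(1)[OF sE]] .
    moreover have "subalgebra_axioms F E R"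
      using FE subringE(6)[OF subfieldE(1)[OF sE]] by (auto simp: subalgebra_axioms_def)
    ultimately show ?thesis by (simp add: subalgebra_def)
  qed
  then have "finite_dimension F E"
    using subalbegra_incl_imp_finite_dimension[OF sF finite_dimensionI[OF dim]] subfieldE(3)[OF sE] by blast
  then obtain l where l: "dimension l F E" by blast
  \<comment> \<open>On \<open>E\<close> the automorphism \<open>\<tau>\<close> itself has period \<open>s\<close>.\<close>
  have "l \<le> s"
  proof -
    obtain Us where Us: "set Us \<subseteq> carrier R" "independent F Us" "length Us = l" "Span F Us = E"
      using exists_base[OF sF l] by blast
    have "set Us \<subseteq> E" using Span_base_incl[OF sF Us(1)] Us(4) by simp
    then have "length Us \<le> s"
      by (intro artin_inequality[OF hom F n(2) Us(2)]) (auto simp: E)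
    then show ?thesis using Us(3) by simp
  qed
  have "dimension (l * k) F (carrier R)"
    by (rule telescopic_base[OF sF sE l k(2)])
  then have "l * k = s * r" using dimension_is_inj[OF sF dim] n(1) by simp
  then have "s * r \<le> l * r" "s * r \<le> s * k"
    using mult_le_mono2[OF k(1), of l] mult_le_mono1[OF \<open>l \<le> s\<close>, of k] by simp_all
  then have "l = s" "k = r" using \<open>l \<le> s\<close> k(1) n(2,3) by simp_all
  then show "dimension r E (carrier R)" "dimension s F E" using k(2) l by auto
qed

section \<open>Cyclic Galois algebras with no further automorphisms\<close>

lemma mem_aut_group:
  "\<tau> \<in> carrier (aut_group F K) \<longleftrightarrow>
    \<tau> \<in> ring_hom K K \<and> \<tau> \<in> Bij (carrier K) \<and> (\<forall>x\<in>F. \<tau> x = x)"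
  by (auto simp: aut_group_def)

lemma aut_group_subgroup:
  assumes "ring K" and FK: "F \<subseteq> carrier K"
  shows "subgroup (carrier (aut_group F K)) (BijGroup (carrier K))"
proof -
  interpret ring K by fact
  interpret B: group "BijGroup (carrier K)" by (rule group_BijGroup)
  show ?thesis
  proof (rule B.subgroupI)
    show "carrier (aut_group F K) \<subseteq> carrier (BijGroup (carrier K))"
      by (auto simp: mem_aut_group BijGroup_def)
    have "(\<lambda>x\<in>carrier K. x) \<in> carrier (aut_group F K)"
      using FK by (auto simp: mem_aut_group id_Bij ring_hom_def)
    then show "carrier (aut_group F K) \<noteq> {}" by auto
  next
    fix \<tau> assume \<tau>: "\<tau> \<in> carrier (aut_group F K)"
    then have B: "\<tau> \<in> Bij (carrier K)" and hom: "\<tau> \<in> ring_hom K K" and fx: "\<And>x. x \<in> F \<Longrightarrow> \<tau> x = x"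
      by (auto simp: mem_aut_group)
    have inj: "inj_on \<tau> (carrier K)" using B by (auto simp: Bij_def bij_betw_def)
    let ?i = "\<lambda>x\<in>carrier K. inv_into (carrier K) \<tau> x"
    have cl: "inv_into (carrier K) \<tau> x \<in> carrier K" if "x \<in> carrier K" for x
      using Bij_inv_into_mem[OF B that] .
    have fix_inv: "inv_into (carrier K) \<tau> x = x" if "x \<in> carrier K" "\<tau> x = x" for x
      using inv_into_f_f[OF inj that(1)] that(2) by simp
    have "?i \<in> ring_hom K K"
    proof (rule ring_hom_memI)
      fix x y assume xy: "x \<in> carrier K" "y \<in> carrier K"
      show "?i x \<in> carrier K" using cl xy by simp
      show "?i (x \<otimes>\<^bsub>K\<^esub> y) = ?i x \<otimes>\<^bsub>K\<^esub> ?i y"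
        using xy Bij_inv_into_lemma[of "carrier K" \<tau> "(\<otimes>\<^bsub>K\<^esub>)" x y] B ring_hom_mult[OF hom] by auto
      show "?i (x \<oplus>\<^bsub>K\<^esub> y) = ?i x \<oplus>\<^bsub>K\<^esub> ?i y"
        using xy Bij_inv_into_lemma[of "carrier K" \<tau> "(\<oplus>\<^bsub>K\<^esub>)" x y] B ring_hom_add[OF hom] by auto
    next
      show "?i \<one>\<^bsub>K\<^esub> = \<one>\<^bsub>K\<^esub>" using fix_inv ring_hom_one[OF hom] by simp
    qed
    moreover have "?i \<in> Bij (carrier K)" by (rule restrict_inv_into_Bij[OF B])
    moreover have "\<forall>x\<in>F. ?i x = x" using fix_inv fx FK by auto
    ultimately show "inv\<^bsub>BijGroup (carrier K)\<^esub> \<tau> \<in> carrier (aut_group F K)"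
      unfolding inv_BijGroup[OF B] by (simp add: mem_aut_group)
  next
    fix \<tau> \<tau>' assume a: "\<tau> \<in> carrier (aut_group F K)" "\<tau>' \<in> carrier (aut_group F K)"
    then have B: "\<tau> \<in> Bij (carrier K)" "\<tau>' \<in> Bij (carrier K)"
      and hom: "\<tau> \<in> ring_hom K K" "\<tau>' \<in> ring_hom K K" and fx: "\<And>x. x \<in> F \<Longrightarrow> \<tau> x = x \<and> \<tau>' x = x"
      by (auto simp: mem_aut_group)
    have "compose (carrier K) \<tau> \<tau>' \<in> ring_hom K K"
      using ring_hom_trans[OF hom(2,1)] by (auto simp: ring_hom_def compose_def)
    then show "\<tau> \<otimes>\<^bsub>BijGroup (carrier K)\<^esub> \<tau>' \<in> carrier (aut_group F K)"
      using compose_Bij[OF B] B fx FK by (auto simp: mem_aut_group BijGroup_def compose_def)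
  qed
qed

lemma aut_group_group: "ring K \<Longrightarrow> F \<subseteq> carrier K \<Longrightarrow> group (aut_group F K)"
  using subgroup.subgroup_is_group[OF aut_group_subgroup group_BijGroup]
  by (simp add: aut_group_def)

lemma aut_group_pow_apply:
  assumes "ring K" "F \<subseteq> carrier K" "\<tau> \<in> carrier (aut_group F K)" "x \<in> carrier K"
  shows "(\<tau> [^]\<^bsub>aut_group F K\<^esub> (i::nat)) x = (\<tau> ^^ i) x"
proof -
  interpret G: group "aut_group F K" by (rule aut_group_group[OF assms(1,2)])
  have *: "(\<alpha> \<otimes>\<^bsub>aut_group F K\<^esub> \<beta>) y = \<alpha> (\<beta> y)"
    if "\<alpha> \<in> carrier (aut_group F K)" "\<beta> \<in> carrier (aut_group F K)" "y \<in> carrier K" for \<alpha> \<beta> y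
    using that by (auto simp: mem_aut_group) (simp add: aut_group_def BijGroup_def compose_def)
  have cl: "\<tau> y \<in> carrier K" if "y \<in> carrier K" for y
    using that assms(3) by (auto simp: mem_aut_group dest: ring_hom_closed)
  show ?thesis
    using assms(4)
  proof (induct i arbitrary: x)
    case 0
    then show ?case by (simp add: aut_group_def BijGroup_def)
  next
    case (Suc i)
    have "(\<tau> [^]\<^bsub>aut_group F K\<^esub> Suc i) x = (\<tau> [^]\<^bsub>aut_group F K\<^esub> i) (\<tau> x)"
      using Suc assms(3) * by simp
    then show ?case using Suc cl by (simp add: funpow_swap1)
  qed
qed

text \<open>
  A Galois \<open>C\<^sub>n\<close>-algebra \<open>K/F\<close> with group \<open>\<langle>\<theta>\<rangle>\<close> which has no other \<open>F\<close>-automorphisms than the powers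
  of \<open>\<theta>\<close>.
\<close>

locale cyclic_galois = cring K for K (structure) +
  fixes F :: "'a set" and \<theta> :: "'a \<Rightarrow> 'a" and n :: nat
  assumes galois: "galois_cyclic_algebra F K n \<theta>"
    and full: "carrier (aut_group F K) = generate (aut_group F K) {\<theta>}"
begin

abbreviation "G \<equiv> aut_group F K"

lemma F_subfield: "subfield F K"
  using galois by (simp add: galois_cyclic_algebra_def etale_algebra_def)

lemma F_sub: "F \<subseteq> carrier K"
  by (rule subfieldE(3)[OF F_subfield])

sublocale G: group G
  by (rule aut_group_group[OF ring_axioms F_sub])

lemma theta_G: "\<theta> \<in> carrier G"
  using galois by (simp add: galois_cyclic_algebra_def)

lemma theta_hom: "\<theta> \<in> ring_hom K K"
  using theta_G by (simp add: mem_aut_group)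

lemma pow_apply: "x \<in> carrier K \<Longrightarrow> (\<theta> [^]\<^bsub>G\<^esub> (i::nat)) x = (\<theta> ^^ i) x"
  by (rule aut_group_pow_apply[OF ring_axioms F_sub theta_G])

lemma one_neq_zero: "\<one> \<noteq> \<zero>"
  using subfieldE(6)[OF F_subfield] by simp

lemma dim_K: "dimension n F (carrier K)"
  using galois by (simp add: galois_cyclic_algebra_def)

lemma n_pos: "0 < n"
proof (rule ccontr)
  assume "\<not> 0 < n"
  then have "carrier K = {\<zero>}" using dimension_zero[OF F_subfield] dim_K by simp
  then show False using one_neq_zero one_closed by blast
qed

lemma ord_theta: "G.ord \<theta> = n"
  using galois by (simp add: galois_cyclic_algebra_def)

lemma G_eqI:
  assumes "\<alpha> \<in> carrier G" "\<beta> \<in> carrier G" "\<And>x. x \<in> carrier K \<Longrightarrow> \<alpha> x = \<beta> x"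
  shows "\<alpha> = \<beta>"
  using assms by (auto simp: mem_aut_group intro!: extensionalityI[of _ "carrier K"] dest: Bij_imp_extensional)

lemma pow_id_iff: "(\<forall>x\<in>carrier K. (\<theta> ^^ i) x = x) \<longleftrightarrow> n dvd i"
proof -
  have "n dvd i \<longleftrightarrow> \<theta> [^]\<^bsub>G\<^esub> i = \<one>\<^bsub>G\<^esub>"
    using G.pow_eq_id[OF theta_G, of i] ord_theta by simp
  also have "\<dots> \<longleftrightarrow> (\<forall>x\<in>carrier K. (\<theta> ^^ i) x = x)"
  proof
    assume "\<theta> [^]\<^bsub>G\<^esub> i = \<one>\<^bsub>G\<^esub>"
    then show "\<forall>x\<in>carrier K. (\<theta> ^^ i) x = x"
      using pow_apply[of _ i] by (metis funpow_0 pow_apply G.nat_pow_0)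
  next
    assume *: "\<forall>x\<in>carrier K. (\<theta> ^^ i) x = x"
    show "\<theta> [^]\<^bsub>G\<^esub> i = \<one>\<^bsub>G\<^esub>"
    proof (rule G_eqI)
      fix x assume x: "x \<in> carrier K"
      have "\<one>\<^bsub>G\<^esub> x = x" using pow_apply[OF x, of 0] by simp
      then show "(\<theta> [^]\<^bsub>G\<^esub> i) x = \<one>\<^bsub>G\<^esub> x" using * x pow_apply by simp
    qed (use theta_G in auto)
  qed
  finally show ?thesis by simp
qed

lemma period: "x \<in> carrier K \<Longrightarrow> (\<theta> ^^ n) x = x"
  using pow_id_iff[of n] by simp

lemma pow_hom: "\<theta> ^^ i \<in> ring_hom K K"
  by (rule ring_hom_funpow[OF theta_hom])

lemma G_pow: "carrier G = {\<theta> [^]\<^bsub>G\<^esub> (k::nat) | k. True}"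
  using full G.generate_pow_nat[OF theta_G] n_pos ord_theta by auto

lemma fixed_iff: "x \<in> carrier K \<Longrightarrow> \<theta> x = x \<longleftrightarrow> x \<in> F"
proof
  assume x: "x \<in> carrier K" and "\<theta> x = x"
  then have "(\<theta> ^^ k) x = x" for k by (induct k) auto
  then have "\<forall>\<tau>\<in>generate G {\<theta>}. \<tau> x = x"
    using x pow_apply unfolding full[symmetric] G_pow by auto
  moreover have "{x \<in> carrier K. \<forall>\<tau>\<in>generate G {\<theta>}. \<tau> x = x} = F"
    using galois by (simp add: galois_cyclic_algebra_def)
  ultimately show "x \<in> F" using x by blast
next
  assume "x \<in> F"
  then show "\<theta> x = x" using theta_G by (simp add: mem_aut_group)
qed

lemma automorphism_is_pow:
  assumes "\<tau> \<in> carrier G"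
  obtains k where "\<And>x. x \<in> carrier K \<Longrightarrow> \<tau> x = (\<theta> ^^ k) x"
  using assms pow_apply unfolding G_pow by auto

text \<open>
  The unit element of a factor of an etale algebra: every nonzero element of the ideal that it
  generates divides it.
\<close>

lemma primitive_idempotent:
  obtains e where "e \<in> carrier K" "e \<noteq> \<zero>" "e \<otimes> e = e"
    "\<And>x. x \<in> carrier K \<Longrightarrow> e \<otimes> x \<noteq> \<zero> \<Longrightarrow> \<exists>y\<in>carrier K. e \<otimes> x \<otimes> y = e"
proof -
  obtain Ls :: "'a ring list" and \<phi> where \<phi>: "\<phi> \<in> ring_iso K (RDirProd_list Ls)"
    and fs: "\<And>i. i < length Ls \<Longrightarrow> finite_separable_extension (Ls ! i) ((\<lambda>x. \<phi> x ! i) ` F)"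
    using galois unfolding galois_cyclic_algebra_def etale_algebra_def by blast
  have fld: "field (Ls ! i)" if "i < length Ls" for i
    using fs[OF that] by (simp add: finite_separable_extension_def)
  show ?thesis
  proof (cases Ls)
    case Nil
    then have "\<phi> \<one> = \<phi> \<zero>"
      using ring_iso_memE(1)[OF \<phi>, of \<one>] ring_iso_memE(1)[OF \<phi>, of \<zero>] by simp
    then have False
      using \<phi> one_neq_zero by (auto simp: ring_iso_def bij_betw_def inj_on_def)
    then show ?thesis ..
  next
    case (Cons L Ls')
    interpret L: field L using fld[of 0] Cons by simp
    interpret P: ring "RDirProd_list Ls'"
    proof (rule RDirProd_list_is_ring)
      fix i assume "i < length Ls'"
      then have "field (Ls' ! i)" using fld[of "Suc i"] Cons by simp
      then show "ring (Ls' ! i)" by (rule field.is_ring)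
    qed
    let ?R = "RDirProd L (RDirProd_list Ls')"
    obtain \<psi> where \<psi>: "\<psi> \<in> ring_iso K ?R"
      using ring_iso_set_trans[OF \<phi>[unfolded Cons] RDirProd_list_iso2] by blast
    have inj: "inj_on \<psi> (carrier K)" and surj: "\<psi> ` carrier K = carrier L \<times> carrier (RDirProd_list Ls')"
      using \<psi> by (auto simp: ring_iso_def bij_betw_def RDirProd_carrier)
    have mult: "\<psi> (x \<otimes> y) = (fst (\<psi> x) \<otimes>\<^bsub>L\<^esub> fst (\<psi> y), snd (\<psi> x) \<otimes>\<^bsub>RDirProd_list Ls'\<^esub> snd (\<psi> y))"
      if "x \<in> carrier K" "y \<in> carrier K" for x y
      using ring_iso_memE(2)[OF \<psi> that]
      by (simp add: RDirProd_def DirProd_def monoid.defs case_prod_beta)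
    have cl: "fst (\<psi> x) \<in> carrier L" "snd (\<psi> x) \<in> carrier (RDirProd_list Ls')" if "x \<in> carrier K" for x
      using surj that by (metis imageI mem_Times_iff)+
    have zero: "\<psi> \<zero> = (\<zero>\<^bsub>L\<^esub>, \<zero>\<^bsub>RDirProd_list Ls'\<^esub>)"
    proof -
      obtain z where z: "z \<in> carrier K" "\<psi> z = (\<zero>\<^bsub>L\<^esub>, \<zero>\<^bsub>RDirProd_list Ls'\<^esub>)"
        using surj by (metis (no_types, lifting) L.zero_closed P.zero_closed SigmaI imageE)
      then have "\<psi> (z \<otimes> \<zero>) = (\<zero>\<^bsub>L\<^esub>, \<zero>\<^bsub>RDirProd_list Ls'\<^esub>)"
        using cl[of \<zero>] by (simp only: mult zero_closed) simp
      then show ?thesis using z by simp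
    qed
    obtain e where e: "e \<in> carrier K" "\<psi> e = (\<one>\<^bsub>L\<^esub>, \<zero>\<^bsub>RDirProd_list Ls'\<^esub>)"
      using surj by (metis (no_types, lifting) L.one_closed P.zero_closed SigmaI imageE)
    show ?thesis
    proof (rule that[of e])
      show "e \<noteq> \<zero>" using e zero by auto
      show "e \<otimes> e = e"
        using e mult[of e e] by (intro inj_onD[OF inj]) auto
      fix x assume x: "x \<in> carrier K" and nz: "e \<otimes> x \<noteq> \<zero>"
      have ex: "\<psi> (e \<otimes> x) = (fst (\<psi> x), \<zero>\<^bsub>RDirProd_list Ls'\<^esub>)"
        using mult[OF e(1) x] e(2) cl[OF x] by simp
      then have "fst (\<psi> x) \<noteq> \<zero>\<^bsub>L\<^esub>"
        using nz zero e(1) x inj_onD[OF inj, of "e \<otimes> x" \<zero>] by auto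
      then have u: "fst (\<psi> x) \<in> Units L" using cl[OF x] by (simp add: L.field_Units)
      then obtain y where y: "y \<in> carrier K" "\<psi> y = (inv\<^bsub>L\<^esub> (fst (\<psi> x)), \<zero>\<^bsub>RDirProd_list Ls'\<^esub>)"
        using surj by (metis (no_types, lifting) L.Units_inv_closed P.zero_closed SigmaI imageE)
      have "\<psi> (e \<otimes> x \<otimes> y) = \<psi> e"
        using mult[of "e \<otimes> x" y] ex e x y u by simp
      then have "e \<otimes> x \<otimes> y = e" using e(1) x y(1) by (intro inj_onD[OF inj]) auto
      then show "\<exists>y\<in>carrier K. e \<otimes> x \<otimes> y = e" using y(1) by blast
    qed (rule e(1))
  qed
qed

lemma fixed_idempotent:
  assumes e: "e \<in> carrier K" "e \<noteq> \<zero>" "e \<otimes> e = e" "\<theta> e = e"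
  shows "e = \<one>"
proof -
  have "e \<in> F - {\<zero>}" using fixed_iff e by simp
  then have i: "inv e \<in> F" "e \<otimes> inv e = \<one>"
    using subfield_m_inv[OF F_subfield] by auto
  then have ic: "inv e \<in> carrier K" using F_sub by auto
  have "e = e \<otimes> (e \<otimes> inv e)" using i e(1) by simp
  also have "\<dots> = e \<otimes> inv e" using e ic by (simp add: m_assoc[symmetric])
  finally show ?thesis using i by simp
qed

lemma pow_inverse:
  assumes "x \<in> carrier K"
  shows "(\<theta> ^^ (n * i - i)) ((\<theta> ^^ i) x) = x" "(\<theta> ^^ i) ((\<theta> ^^ (n * i - i)) x) = x"
proof -
  have "n * i - i + i = n * i" "i + (n * i - i) = n * i" using n_pos by simp_all
  moreover have "(\<theta> ^^ (n * i)) x = x" using pow_id_iff[of "n * i"] assms by simp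
  ultimately show "(\<theta> ^^ (n * i - i)) ((\<theta> ^^ i) x) = x" "(\<theta> ^^ i) ((\<theta> ^^ (n * i - i)) x) = x"
    by (metis comp_apply funpow_add)+
qed

text \<open>Distinct conjugates of a primitive idempotent are orthogonal.\<close>

lemma conjugate_orthogonal:
  assumes e: "e \<in> carrier K" "e \<otimes> e = e"
    and prim: "\<And>x. x \<in> carrier K \<Longrightarrow> e \<otimes> x \<noteq> \<zero> \<Longrightarrow> \<exists>y\<in>carrier K. e \<otimes> x \<otimes> y = e"
    and ne: "(\<theta> ^^ i) e \<noteq> e"
  shows "e \<otimes> (\<theta> ^^ i) e = \<zero>"
proof (rule ccontr)
  interpret h: ring_hom_ring K K "\<theta> ^^ j" for j
    by (rule ring_hom_ringI2[OF ring_axioms ring_axioms pow_hom])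
  have absorb: "e \<otimes> p = e" if p: "p \<in> carrier K" "p \<otimes> p = p" "e \<otimes> p \<noteq> \<zero>" for p
  proof -
    obtain y where y: "y \<in> carrier K" "e \<otimes> p \<otimes> y = e" using prim p by blast
    have "e \<otimes> p \<otimes> y \<otimes> p = e \<otimes> (p \<otimes> p) \<otimes> y" using e p(1) y(1) by (simp only: m_ac m_closed)
    then show ?thesis using y p(2) by simp
  qed
  have idem: "(\<theta> ^^ j) e \<otimes> (\<theta> ^^ j) e = (\<theta> ^^ j) e" for j
    using h.hom_mult[OF e(1) e(1), of j] e(2) by simp
  assume nz: "e \<otimes> (\<theta> ^^ i) e \<noteq> \<zero>"
  \<comment> \<open>\<open>n i - i\<close> is a natural number congruent to \<open>- i\<close> modulo \<open>n\<close>.\<close>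
  define q where "q = (\<theta> ^^ (n * i - i)) e"
  have q: "q \<in> carrier K" "(\<theta> ^^ i) q = e" using e pow_inverse[OF e(1)] by (auto simp: q_def)
  have "e \<otimes> q \<noteq> \<zero>"
  proof
    assume "e \<otimes> q = \<zero>"
    then have "(\<theta> ^^ i) e \<otimes> (\<theta> ^^ i) q = \<zero>"
      using h.hom_mult[OF e(1) q(1), of i] by simp
    then show False using nz q e by (simp add: m_comm)
  qed
  then have "e \<otimes> q = e" using absorb q idem by (simp add: q_def)
  then have "(\<theta> ^^ i) e \<otimes> e = (\<theta> ^^ i) e"
    using h.hom_mult[OF e(1) q(1), of i] q(2) by simp
  moreover have "e \<otimes> (\<theta> ^^ i) e = e" using absorb idem nz e(1) by simp
  ultimately show False using ne e(1) m_comm[of e "(\<theta> ^^ i) e"] by simp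
qed

text \<open>
  If a primitive idempotent \<open>e\<close> is not \<open>1\<close>, interchanging the factors of \<open>e\<close> and of \<open>\<theta>(e)\<close> and
  fixing everything else is an automorphism. Being a power of \<open>\<theta>\<close>, it commutes with \<open>\<theta>\<close>, which is
  possible only if these are the only factors and \<open>\<theta>\<close> has order \<open>2\<close>.
\<close>

lemma two_factors:
  assumes e: "e \<in> carrier K" "e \<noteq> \<zero>" "e \<otimes> e = e"
    and prim: "\<And>x. x \<in> carrier K \<Longrightarrow> e \<otimes> x \<noteq> \<zero> \<Longrightarrow> \<exists>y\<in>carrier K. e \<otimes> x \<otimes> y = e"
    and e1: "e \<noteq> \<one>"
  shows "n = 2" and "e \<oplus> \<theta> e = \<one>"
proof -
  interpret h: ring_hom_ring K K \<theta>
    by (rule ring_hom_ringI2[OF ring_axioms ring_axioms theta_hom])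
  \<comment> \<open>\<open>\<theta>'\<close> is the inverse of \<open>\<theta>\<close>.\<close>
  define \<theta>' where "\<theta>' = \<theta> ^^ (n - 1)"
  interpret h': ring_hom_ring K K \<theta>'
    unfolding \<theta>'_def by (rule ring_hom_ringI2[OF ring_axioms ring_axioms pow_hom])
  have inv: "\<theta>' (\<theta> x) = x" "\<theta> (\<theta>' x) = x" if "x \<in> carrier K" for x
    using pow_inverse[OF that, of 1] by (simp_all add: \<theta>'_def)
  define g where "g = \<theta> e"
  have g: "g \<in> carrier K" "g \<otimes> g = g" using e h.hom_mult[OF e(1) e(1)] by (auto simp: g_def)
  have ge: "g \<noteq> e" using fixed_idempotent[OF e] e1 by (auto simp: g_def)
  have eg: "e \<otimes> g = \<zero>"
    using conjugate_orthogonal[OF e(1,3) prim, of 1] ge by (simp add: g_def)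
  define f where "f = \<one> \<ominus> (e \<oplus> g)"
  have f: "f \<in> carrier K" using e g by (simp add: f_def)
  have sum: "e \<oplus> g \<oplus> f = \<one>"
    using e g by (simp add: f_def a_minus_def a_lcomm[of "e \<oplus> g"] r_neg a_comm)
  have eg': "g \<otimes> e = \<zero>" using eg e g by (simp add: m_comm)
  have "e \<oplus> e \<otimes> f = e"
  proof -
    have "e \<otimes> (e \<oplus> g \<oplus> f) = e" using sum e by simp
    then show ?thesis using e g f eg by (simp add: r_distr)
  qed
  then have ef: "e \<otimes> f = \<zero>" using e f by simp
  have "g \<oplus> g \<otimes> f = g"
  proof -
    have "g \<otimes> (e \<oplus> g \<oplus> f) = g" using sum g by simp
    then show ?thesis using e g f eg' by (simp add: r_distr)
  qed
  then have gf: "g \<otimes> f = \<zero>" using g f by simp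
  have fe: "f \<otimes> e = \<zero>" "f \<otimes> g = \<zero>" using ef gf e g f by (simp_all add: m_comm)
  have ff: "f \<otimes> f = f"
  proof -
    have "f \<otimes> (e \<oplus> g \<oplus> f) = f" using sum f by simp
    then show ?thesis using e g f fe by (simp add: r_distr)
  qed
  have dec: "x = x \<otimes> e \<oplus> x \<otimes> g \<oplus> x \<otimes> f" if "x \<in> carrier K" for x
  proof -
    have "x \<otimes> (e \<oplus> g \<oplus> f) = x" using sum that by simp
    then show ?thesis using e g f that by (simp add: r_distr)
  qed
  have eqI: "x = y" if "x \<in> carrier K" "y \<in> carrier K" "x \<otimes> e = y \<otimes> e" "x \<otimes> g = y \<otimes> g" "x \<otimes> f = y \<otimes> f"
    for x y using dec[OF that(1)] dec[OF that(2)] that by simp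
  have split: "x \<otimes> y \<otimes> u = (x \<otimes> u) \<otimes> (y \<otimes> u)"
    if "x \<in> carrier K" "y \<in> carrier K" "u \<in> carrier K" "u \<otimes> u = u" for x y u
  proof -
    have "(x \<otimes> u) \<otimes> (y \<otimes> u) = x \<otimes> y \<otimes> (u \<otimes> u)" using that(1-3) by (simp only: m_ac m_closed)
    then show ?thesis using that by simp
  qed
  \<comment> \<open>The automorphism interchanging the factors of \<open>e\<close> and \<open>g\<close>; equations in \<open>K\<close> are checked on the
    components at \<open>e\<close>, \<open>g\<close> and \<open>f\<close>.\<close>
  define p where "p x = \<theta> x \<otimes> g \<oplus> \<theta>' x \<otimes> e \<oplus> x \<otimes> f" for x
  have pc: "p x \<in> carrier K" if "x \<in> carrier K" for x using that e g f by (simp add: p_def)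
  have pe: "p x \<otimes> e = \<theta>' x \<otimes> e" and pg: "p x \<otimes> g = \<theta> x \<otimes> g" and pf: "p x \<otimes> f = x \<otimes> f"
    if "x \<in> carrier K" for x
    using that e g f eg eg' ef gf fe ff by (simp_all add: p_def l_distr m_assoc)
  have g': "\<theta>' g = e" using inv e by (simp add: g_def)
  have pp: "p (p x) = x" if x: "x \<in> carrier K" for x
  proof (rule eqI)
    have "p (p x) \<otimes> e = \<theta>' (p x \<otimes> g)" using pe[OF pc[OF x]] h'.hom_mult[OF pc[OF x] g(1)] g' by simp
    also have "\<dots> = x \<otimes> e" using pg[OF x] x g(1) inv g' by simp
    finally show "p (p x) \<otimes> e = x \<otimes> e" .
    have "p (p x) \<otimes> g = \<theta> (p x \<otimes> e)" using pg[OF pc[OF x]] pc[OF x] e(1) by (simp add: g_def)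
    also have "\<dots> = x \<otimes> g" using pe[OF x] x e(1) inv by (simp add: g_def)
    finally show "p (p x) \<otimes> g = x \<otimes> g" .
    show "p (p x) \<otimes> f = x \<otimes> f" using pf pc x by simp
  qed (use pc x in auto)
  have p_hom: "p \<in> ring_hom K K"
  proof (rule ring_hom_memI)
    fix x y assume xy: "x \<in> carrier K" "y \<in> carrier K"
    show "p x \<in> carrier K" by (rule pc[OF xy(1)])
    show "p (x \<otimes> y) = p x \<otimes> p y"
    proof (rule eqI)
      show "p (x \<otimes> y) \<otimes> e = p x \<otimes> p y \<otimes> e"
        using xy e pc by (simp add: split[of _ _ e] pe)
      show "p (x \<otimes> y) \<otimes> g = p x \<otimes> p y \<otimes> g"
        using xy g pc by (simp add: split[of _ _ g] pg)
      show "p (x \<otimes> y) \<otimes> f = p x \<otimes> p y \<otimes> f"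
        using xy f ff pc by (simp add: split[of _ _ f] pf)
    qed (use pc xy in auto)
    show "p (x \<oplus> y) = p x \<oplus> p y"
      by (rule eqI) (use xy e g f pc in \<open>simp_all add: l_distr pe pg pf\<close>)
  next
    show "p \<one> = \<one>"
      by (rule eqI) (use e g f pc in \<open>simp_all add: pe pg pf\<close>)
  qed
  have fix': "\<theta>' x = x" if "x \<in> F" for x
    using inv(1)[of x] that F_sub fixed_iff[of x] by auto
  let ?p = "\<lambda>x\<in>carrier K. p x"
  have "?p \<in> carrier G"
    unfolding mem_aut_group
  proof (intro conjI ballI)
    show "?p \<in> ring_hom K K" using p_hom by (auto simp: ring_hom_def)
    have "bij_betw p (carrier K) (carrier K)"
      using pp pc by (intro bij_betw_byWitness[of _ p]) auto
    then show "?p \<in> Bij (carrier K)"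
      by (auto simp: Bij_def cong: bij_betw_cong)
    fix x assume x: "x \<in> F"
    then have xc: "x \<in> carrier K" and tx: "\<theta> x = x" using F_sub fixed_iff[of x] by auto
    have "p x = x"
      by (rule eqI) (simp_all add: pe pg pf pc xc tx fix'[OF x])
    then show "?p x = x" using x F_sub by auto
  qed
  then obtain k where k: "\<And>x. x \<in> carrier K \<Longrightarrow> ?p x = (\<theta> ^^ k) x"
    by (rule automorphism_is_pow) (rule that)
  then have comm: "p (\<theta> x) = \<theta> (p x)" if "x \<in> carrier K" for x
    using k[of x] k[of "\<theta> x"] that by (simp add: funpow_swap1)
  have \<theta>_inj: "x = y" if "x \<in> carrier K" "y \<in> carrier K" "\<theta> x = \<theta> y" for x y
    using inv(1) that by metis
  have p_e: "p e = g"
  proof (rule eqI)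
    have "\<theta> (\<theta>' e \<otimes> e) = \<theta> \<zero>"
      using h.hom_mult[of "\<theta>' e" e] e(1) inv(2)[OF e(1)] eg by (simp add: g_def[symmetric])
    then have "\<theta>' e \<otimes> e = \<zero>" by (rule \<theta>_inj[rotated 2]) (simp_all add: e(1))
    then show "p e \<otimes> e = g \<otimes> e" using e eg' by (simp add: pe)
    show "p e \<otimes> g = g \<otimes> g" using pg[OF e(1)] by (simp add: g_def[symmetric])
    show "p e \<otimes> f = g \<otimes> f" using e ef gf by (simp add: pf)
  qed (use pc e g in auto)
  have tg: "\<theta> g = e"
  proof (rule ccontr)
    \<comment> \<open>A third factor would be fixed by \<open>p\<close>; conjugating by \<open>\<theta>\<^sup>2\<close>, so would be the factor of \<open>e\<close>.\<close>
    assume ne: "\<theta> g \<noteq> e"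
    define u where "u = \<theta> g"
    have u: "u \<in> carrier K" using g by (simp add: u_def)
    have eu: "e \<otimes> u = \<zero>"
      using conjugate_orthogonal[OF e(1,3) prim, of 2] ne by (simp add: u_def g_def numeral_2_eq_2)
    have gu: "g \<otimes> u = \<zero>"
      using h.hom_mult[OF e(1) g(1)] eg by (simp add: u_def g_def)
    have "p u = u"
    proof (rule eqI)
      show "p u \<otimes> e = u \<otimes> e"
        using pe[OF u] eu u e g eg' inv by (simp add: u_def m_comm)
      have "\<theta> (e \<otimes> u) = g \<otimes> \<theta> u" using e u by (simp add: g_def)
      then show "p u \<otimes> g = u \<otimes> g"
        using pg[OF u] gu u g eu by (simp add: m_comm)
      show "p u \<otimes> f = u \<otimes> f" by (rule pf[OF u])
    qed (use pc u in auto)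
    moreover have "p u = \<theta> (\<theta> g)"
    proof -
      have "p g = \<theta> g" using comm[OF e(1)] p_e by (simp only: g_def)
      then show ?thesis using comm[OF g(1)] by (simp only: u_def)
    qed
    ultimately have "\<theta> (\<theta> g) = \<theta> g" by (simp add: u_def)
    then have "\<theta> g = g" by (rule \<theta>_inj[rotated 2]) (simp_all add: g(1))
    then have "\<theta> g = \<theta> e" by (simp add: g_def)
    then have "g = e" by (rule \<theta>_inj[rotated 2]) (simp_all add: g(1) e(1))
    then show False using ge by simp
  qed
  show e_sum: "e \<oplus> \<theta> e = \<one>"
  proof (rule fixed_idempotent)
    show "e \<oplus> \<theta> e \<in> carrier K" using e by simp
    have "(e \<oplus> g) \<otimes> e = e" using e g eg' by (simp add: l_distr)
    then show "e \<oplus> \<theta> e \<noteq> \<zero>" using e by (auto simp: g_def[symmetric])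
    show "(e \<oplus> \<theta> e) \<otimes> (e \<oplus> \<theta> e) = e \<oplus> \<theta> e"
      using e g eg eg' by (simp add: g_def[symmetric] l_distr r_distr)
    show "\<theta> (e \<oplus> \<theta> e) = e \<oplus> \<theta> e"
      using e g tg by (simp add: g_def[symmetric] a_comm)
  qed
  have sq: "(\<theta> ^^ 2) x = x" if x: "x \<in> carrier K" for x
  proof -
    have tx: "\<theta> x \<in> carrier K" using x by simp
    have "\<theta> (p x) \<otimes> e = \<theta> (p x \<otimes> g)" using pc[OF x] g tg by simp
    then have 1: "x \<otimes> e = \<theta> (\<theta> x) \<otimes> e"
      using comm[OF x] pe[OF tx] pg[OF x] inv x g tg by simp
    have "\<theta> (p x) \<otimes> g = \<theta> (p x \<otimes> e)" using pc[OF x] e by (simp add: g_def)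
    then have 2: "\<theta> (\<theta> x) \<otimes> g = x \<otimes> g"
      using comm[OF x] pg[OF tx] pe[OF x] inv x e by (simp add: g_def)
    have f0: "f = \<zero>" using e_sum unfolding f_def g_def[symmetric] by (simp add: a_minus_def r_neg)
    have "\<theta> (\<theta> x) = x"
      by (rule eqI[OF _ x 1[symmetric] 2]) (use x in \<open>simp_all add: f0\<close>)
    then show ?thesis by (simp add: numeral_2_eq_2)
  qed
  then have "n dvd 2" using pow_id_iff[of 2] by simp
  then have "n \<le> 2" by (rule dvd_imp_le) simp
  moreover have "n \<noteq> 1"
  proof
    assume "n = 1"
    then have "\<theta> e = e" using period[OF e(1)] by simp
    then show False using ge unfolding g_def by simp
  qed
  ultimately show "n = 2" using n_pos by simp
qed

text \<open>
  Hence \<open>K\<close> is a field or \<open>F \<times> F\<close>; what is needed of the latter is that \<open>x - \<theta>(x)\<close> is zero or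
  not a zero divisor.
\<close>

theorem field_or_swap:
  "field K \<or> (n = 2 \<and> (\<forall>z\<in>carrier K. \<forall>x\<in>carrier K. z \<otimes> x = z \<otimes> \<theta> x \<longrightarrow> z = \<zero> \<or> \<theta> x = x))"
proof -
  interpret h: ring_hom_ring K K \<theta>
    by (rule ring_hom_ringI2[OF ring_axioms ring_axioms theta_hom])
  obtain e where e: "e \<in> carrier K" "e \<noteq> \<zero>" "e \<otimes> e = e"
    and prim: "\<And>x. x \<in> carrier K \<Longrightarrow> e \<otimes> x \<noteq> \<zero> \<Longrightarrow> \<exists>y\<in>carrier K. e \<otimes> x \<otimes> y = e"
    by (rule primitive_idempotent) (rule that)
  show ?thesis
  proof (cases "e = \<one>")
    case True
    then have "field K"
      using prim one_neq_zero by (intro cring_fieldI2) auto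
    then show ?thesis ..
  next
    case False
    note two = two_factors[OF e prim False]
    have "z = \<zero> \<or> \<theta> x = x"
      if z: "z \<in> carrier K" and x: "x \<in> carrier K" and eq: "z \<otimes> x = z \<otimes> \<theta> x" for z x
    proof (cases "\<theta> x = x")
      case ne: False
      define \<delta> where "\<delta> = x \<ominus> \<theta> x"
      have \<delta>: "\<delta> \<in> carrier K" using x by (simp add: \<delta>_def)
      have \<delta>0: "\<delta> \<noteq> \<zero>" using ne x by (simp add: \<delta>_def minus_zero_iff)
      have z\<delta>: "z \<otimes> \<delta> = \<zero>"
        using eq x z by (simp add: \<delta>_def a_minus_def r_distr r_minus r_neg)
      have "\<theta> (\<theta> x) = x" using period[OF x] two(1) by (simp add: numeral_2_eq_2)
      then have t\<delta>: "\<theta> \<delta> = \<ominus> \<delta>" using x by (simp add: \<delta>_def a_minus_def minus_add a_comm)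
      have dec: "y = y \<otimes> e \<oplus> y \<otimes> \<theta> e" if "y \<in> carrier K" for y
        using two(2) that e(1) by (simp add: r_distr[symmetric])
      have "e \<otimes> \<delta> \<noteq> \<zero>"
      proof
        assume 0: "e \<otimes> \<delta> = \<zero>"
        then have "\<theta> e \<otimes> (\<ominus> \<delta>) = \<zero>" using h.hom_mult[OF e(1) \<delta>] t\<delta> by simp
        then have "\<delta> \<otimes> \<theta> e = \<zero>" using e(1) \<delta> by (simp add: r_minus m_comm)
        then show False using dec[OF \<delta>] 0 \<delta>0 \<delta> e(1) by (simp add: m_comm)
      qed
      then obtain y where y: "y \<in> carrier K" "e \<otimes> \<delta> \<otimes> y = e" using prim \<delta> by blast
      have "z \<otimes> (e \<otimes> \<delta> \<otimes> y) = z \<otimes> \<delta> \<otimes> (e \<otimes> y)"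
        using z e(1) \<delta> y(1) by (simp only: m_ac m_closed)
      then have ze: "z \<otimes> e = \<zero>" using y z\<delta> e(1) by simp
      have "\<theta> e = \<theta> e \<otimes> (\<ominus> \<delta>) \<otimes> \<theta> y"
        using arg_cong[OF y(2), of \<theta>] e(1) \<delta> y(1) t\<delta> by simp
      then have "z \<otimes> \<theta> e = z \<otimes> (\<theta> e \<otimes> (\<ominus> \<delta>) \<otimes> \<theta> y)" by simp
      also have "\<dots> = (\<ominus> (z \<otimes> \<delta>)) \<otimes> (\<theta> e \<otimes> \<theta> y)"
        using z e(1) \<delta> y(1) by (simp add: m_ac l_minus r_minus)
      finally have "z \<otimes> \<theta> e = \<zero>" using z\<delta> e(1) y(1) by simp
      then show ?thesis using dec[OF z] ze by simp
    qed simp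
    then show ?thesis using two(1) by blast
  qed
qed

end

section \<open>The right nucleus as a Petit algebra in \<open>t\<^sup>s\<close>\<close>

text \<open>
  The right nucleus enters only through its support, so no regularity of \<open>K\<close> is needed here. In the
  product in \<open>A\<close> of two elements supported on multiples of \<open>s\<close>, only the indices \<open>s j\<close> contribute, with
  the terms of the product in \<open>K[t;\<tau>]/K[t;\<tau>](t\<^sup>r - d)\<close>.
\<close>

lemma (in cyclic_petit) subst_pow_iso:
  assumes m: "m = s * r" and s: "0 < s" and B: "cyclic_petit K \<tau> r d"
    and \<tau>: "\<And>x. x \<in> carrier K \<Longrightarrow> \<tau> x = (\<rho> ^^ s) x"
    and N: "nuc_r A = {z \<in> carrier A. \<forall>c<m. \<not> s dvd c \<longrightarrow> z c = \<zero>}"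
  shows "subst_pow K s \<in> ring_iso (cyclic_alg K \<tau> r d) (A\<lparr>carrier := nuc_r A\<rparr>)"
proof -
  interpret B: cyclic_petit K \<tau> r d by (rule B)
  let ?S = "subst_pow K s"
  have \<tau>_pow: "(\<tau> ^^ i) x = (\<rho> ^^ (s * i)) x" if "x \<in> carrier K" for i x
    using that by (induct i) (simp_all add: \<tau> funpow_add)
  have SA: "?S g \<in> carrier A" if g: "g \<in> carrier B.A" for g
  proof (rule alg_memI)
    fix i
    show "?S g i \<in> carrier K" using g by (simp add: subst_pow_def)
    assume "m \<le> i"
    then have "s dvd i \<Longrightarrow> r \<le> i div s" using m s by (auto elim!: dvdE)
    then show "?S g i = \<zero>" using g by (simp add: subst_pow_def)
  qed
  have SN: "?S g \<in> nuc_r A" if g: "g \<in> carrier B.A" for g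
    unfolding N using SA[OF g] by (auto simp: subst_pow_def)
  have dvd_diff: "s dvd (m + k - i) mod m \<longleftrightarrow> s dvd k" if "s dvd i" "i < m" for i k
  proof -
    have "m + k - i + i = m + k" using that by simp
    then have "s dvd m + k - i \<longleftrightarrow> s dvd m + k"
      using that(1) by (metis dvd_add_left_iff)
    moreover have "s dvd m + k \<longleftrightarrow> s dvd k"
      unfolding m by (rule dvd_add_right_iff) simp
    moreover have "s dvd (m + k - i) mod m \<longleftrightarrow> s dvd m + k - i"
      using m by (intro dvd_mod_iff) simp
    ultimately show ?thesis by simp
  qed
  have mult: "?S (g \<otimes>\<^bsub>B.A\<^esub> h) = ?S g \<otimes>\<^bsub>A\<^esub> ?S h"
    if g: "g \<in> carrier B.A" and h: "h \<in> carrier B.A" for g h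
  proof (rule alg_eqI)
    show "?S (g \<otimes>\<^bsub>B.A\<^esub> h) \<in> carrier A" using SA B.alg_mult_closed g h by blast
    show "?S g \<otimes>\<^bsub>A\<^esub> ?S h \<in> carrier A" using SA g h by simp
    fix k assume k: "k < m"
    let ?T = "\<lambda>i. ?S g i \<otimes> (\<rho> ^^ i) (?S h ((m + k - i) mod m)) \<otimes> tw i k"
    have Tc: "?T i \<in> carrier K" for i using SA[OF g] SA[OF h] by simp
    have app: "(?S g \<otimes>\<^bsub>A\<^esub> ?S h) k = (\<Oplus>i\<in>{..<m}. ?T i)"
      by (rule mult_app[OF SA[OF g] SA[OF h] k])
    show "?S (g \<otimes>\<^bsub>B.A\<^esub> h) k = (?S g \<otimes>\<^bsub>A\<^esub> ?S h) k"
    proof (cases "s dvd k")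
      case False
      have "?T i = \<zero>" if "i < m" for i
      proof (cases "s dvd i")
        case True
        then have "?S h ((m + k - i) mod m) = \<zero>"
          using dvd_diff[OF True that, of k] False by (simp add: subst_pow_def)
        then show ?thesis using SA[OF g] by simp
      next
        case ndvd: False
        then have "?S g i = \<zero>" by (simp add: subst_pow_def)
        then show ?thesis using alg_closed[OF SA[OF h]] by simp
      qed
      then have "(\<Oplus>i\<in>{..<m}. ?T i) = \<zero>" by (intro add.finprod_one_eqI) simp
      then show ?thesis unfolding app using False by (simp add: subst_pow_def)
    next
      case True
      then obtain k' where k': "k = s * k'" ..
      then have kr: "k' < r" using k m by simp
      have inj: "inj_on ((*) s) {..<r}" using s by (auto simp: inj_on_def)
      have "(\<Oplus>i\<in>{..<m}. ?T i) = (\<Oplus>i\<in>(*) s ` {..<r}. ?T i)"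
      proof (rule finsum_restrict)
        show "(*) s ` {..<r} \<subseteq> {..<m}" using m s by auto
        fix i assume i: "i \<in> {..<m}" "i \<notin> (*) s ` {..<r}"
        then have "\<not> s dvd i" using m by (auto elim!: dvdE)
        then have "?S g i = \<zero>" by (simp add: subst_pow_def)
        then show "?T i = \<zero>" using alg_closed[OF SA[OF h]] by simp
      qed (use Tc in auto)
      also have "\<dots> = (\<Oplus>j\<in>{..<r}. ?T (s * j))"
        using Tc inj by (intro finsum_reindex) auto
      also have "\<dots> = (\<Oplus>j\<in>{..<r}. g j \<otimes> (\<tau> ^^ j) (h ((r + k' - j) mod r)) \<otimes> B.tw j k')"
      proof (rule finsum_cong')
        fix j assume "j \<in> {..<r}"
        have sub: "m + k - s * j = s * (r + k' - j)"
          using m k' by (simp add: distrib_left right_diff_distrib')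
        have "(m + k - s * j) mod m = s * (r + k' - j) mod (s * r)"
          unfolding sub by (simp only: m)
        also have "\<dots> = s * ((r + k' - j) mod r)" by (rule mult_mod_right[symmetric])
        finally have "?S h ((m + k - s * j) mod m) = h ((r + k' - j) mod r)"
          using s by (simp add: subst_pow_def)
        moreover have "?S g (s * j) = g j" using s by (simp add: subst_pow_def)
        moreover have "tw (s * j) k = B.tw j k'"
          using s unfolding k' tw_def B.tw_def by (simp add: \<tau>_pow[OF d_closed])
        ultimately show "?T (s * j) = g j \<otimes> (\<tau> ^^ j) (h ((r + k' - j) mod r)) \<otimes> B.tw j k'"
          using \<tau>_pow[OF B.alg_closed[OF h]] by simp
      qed (use g h in auto)
      also have "\<dots> = (g \<otimes>\<^bsub>B.A\<^esub> h) k'"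
        by (rule B.mult_app[OF g h kr, symmetric])
      finally show ?thesis unfolding app using k' s by (simp add: subst_pow_def)
    qed
  qed
  have "?S \<in> ring_hom B.A (A\<lparr>carrier := nuc_r A\<rparr>)"
  proof (rule ring_hom_memI)
    fix g h assume gh: "g \<in> carrier B.A" "h \<in> carrier B.A"
    show "?S g \<in> carrier (A\<lparr>carrier := nuc_r A\<rparr>)" using SN gh by simp
    show "?S (g \<otimes>\<^bsub>B.A\<^esub> h) = ?S g \<otimes>\<^bsub>A\<lparr>carrier := nuc_r A\<rparr>\<^esub> ?S h" using mult gh by simp
    show "?S (g \<oplus>\<^bsub>B.A\<^esub> h) = ?S g \<oplus>\<^bsub>A\<lparr>carrier := nuc_r A\<rparr>\<^esub> ?S h"
      using add_alg[OF SA[OF gh(1)] SA[OF gh(2)]] gh by (auto simp: B.add_alg subst_pow_def)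
  next
    show "?S \<one>\<^bsub>B.A\<^esub> = \<one>\<^bsub>A\<lparr>carrier := nuc_r A\<rparr>\<^esub>"
      by (auto simp: fun_eq_iff B.one_alg one_alg subst_pow_def dvd_div_eq_0_iff)
  qed
  moreover have "bij_betw ?S (carrier B.A) (nuc_r A)"
    unfolding bij_betw_def
  proof
    show "inj_on ?S (carrier B.A)"
    proof (rule inj_onI)
      fix g h assume "?S g = ?S h"
      then have "?S g (s * i) = ?S h (s * i)" for i by simp
      then show "g = h" using s by (auto simp: subst_pow_def)
    qed
    show "?S ` carrier B.A = nuc_r A"
    proof
      show "?S ` carrier B.A \<subseteq> nuc_r A" using SN by auto
      show "nuc_r A \<subseteq> ?S ` carrier B.A"
      proof
        fix z assume z: "z \<in> nuc_r A"
        then have zA: "z \<in> carrier A" and z0: "\<And>c. c < m \<Longrightarrow> \<not> s dvd c \<Longrightarrow> z c = \<zero>"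
          unfolding N by auto
        have "z c = \<zero>" if "\<not> s dvd c" for c
          using z0[of c] that zA by (cases "c < m") auto
        then have "z = ?S (\<lambda>i. z (s * i))" by (auto simp: subst_pow_def)
        moreover have "(\<lambda>i. z (s * i)) \<in> carrier B.A"
          using zA m by (intro B.alg_memI) auto
        ultimately show "z \<in> ?S ` carrier B.A" by blast
      qed
    qed
  qed
  ultimately show ?thesis by (simp add: ring_iso_def)
qed

text \<open>The not necessarily associative algebra \<open>(K/F, \<theta>, d)\<close>\<close>

locale nonassociative_cyclic = cyclic_galois K F \<theta> n for K (structure) and F \<theta> n +
  fixes d :: 'a
  assumes d_in: "d \<in> carrier K"
begin

sublocale cyclic_petit K \<theta> n d
  by unfold_locales (use theta_hom period n_pos d_in one_neq_zero in auto)

abbreviation "H \<equiv> {\<tau> \<in> carrier G. \<tau> d = d}"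

lemma associative_iff: "associative_alg A \<longleftrightarrow> d \<in> F"
  using associative_if_fixed fixed_if_associative fixed_iff[OF d_in] by blast

lemma generate_pow_theta:
  assumes "0 < s" "s dvd n"
  shows "generate G {\<theta> [^]\<^bsub>G\<^esub> s} = {\<theta> [^]\<^bsub>G\<^esub> (s * k) | k. True}"
proof -
  have "G.ord (\<theta> [^]\<^bsub>G\<^esub> s) = n div s"
    using G.ord_pow[OF theta_G] assms ord_theta by simp
  moreover have "n div s \<noteq> 0" using assms n_pos by (auto elim!: dvdE)
  ultimately show ?thesis
    using G.generate_pow_nat[of "\<theta> [^]\<^bsub>G\<^esub> s"] theta_G by (simp add: G.nat_pow_pow)
qed

text \<open>The stabilizer of \<open>d\<close> is generated by the least positive power of \<open>\<theta>\<close> which fixes \<open>d\<close>.\<close>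

lemma stabilizer_cyclic:
  obtains s where "0 < s" "s dvd n" "H = generate G {\<theta> [^]\<^bsub>G\<^esub> s}"
proof -
  define P where "P s \<longleftrightarrow> 0 < s \<and> (\<theta> ^^ s) d = d" for s
  define s where "s = (LEAST s. P s)"
  have "P n" using period[OF d_in] n_pos by (simp add: P_def)
  then have Ps: "P s" unfolding s_def by (rule LeastI)
  then have s: "0 < s" "(\<theta> ^^ s) d = d" by (simp_all add: P_def)
  have mult: "(\<theta> ^^ (s * q)) d = d" for q
    by (induct q) (simp_all add: funpow_add s(2))
  have iff: "(\<theta> ^^ c) d = d \<longleftrightarrow> s dvd c" for c
  proof
    assume "(\<theta> ^^ c) d = d"
    moreover have "c = c mod s + s * (c div s)" by simp
    ultimately have "(\<theta> ^^ (c mod s)) d = d"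
      using mult[of "c div s"] by (metis comp_apply funpow_add)
    then have "\<not> 0 < c mod s"
      using Least_le[of P "c mod s", folded s_def] mod_less_divisor[OF s(1), of c]
      unfolding P_def by linarith
    then show "s dvd c" by (simp add: mod_eq_0_iff_dvd)
  qed (auto simp: mult elim!: dvdE)
  have sn: "s dvd n" using iff[of n] period[OF d_in] by simp
  moreover have "H = generate G {\<theta> [^]\<^bsub>G\<^esub> s}"
    unfolding generate_pow_theta[OF s(1) sn] G_pow using pow_apply[OF d_in] iff
    by (auto elim!: dvdE)
  ultimately show ?thesis using that s(1) by blast
qed

lemma pow_fixes_iff:
  assumes s: "0 < s" "s dvd n" and H: "H = generate G {\<theta> [^]\<^bsub>G\<^esub> s}"
  shows "(\<theta> ^^ c) d = d \<longleftrightarrow> s dvd c"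
proof -
  have "(\<theta> ^^ c) d = d \<longleftrightarrow> \<theta> [^]\<^bsub>G\<^esub> c \<in> H"
    using pow_apply[OF d_in, of c] theta_G by simp
  also have "\<dots> \<longleftrightarrow> (\<exists>k. \<theta> [^]\<^bsub>G\<^esub> c = \<theta> [^]\<^bsub>G\<^esub> (s * k))"
    unfolding H generate_pow_theta[OF s] by blast
  also have "\<dots> \<longleftrightarrow> s dvd c"
  proof
    assume "\<exists>k. \<theta> [^]\<^bsub>G\<^esub> c = \<theta> [^]\<^bsub>G\<^esub> (s * k)"
    then obtain k where "\<theta> [^]\<^bsub>G\<^esub> c = \<theta> [^]\<^bsub>G\<^esub> (s * k)" ..
    then have "int n dvd int (s * k) - int c"
      using G.int_pow_eq[OF theta_G, of "int c" "int (s * k)"] unfolding ord_theta int_pow_int by blast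
    then have "int s dvd int (s * k) - int c"
      using s(2) by (meson dvd_trans int_dvd_int_iff)
    then have "int s dvd int c" by (simp add: dvd_diff_right_iff)
    then show "s dvd c" by simp
  qed (auto elim!: dvdE)
  finally show ?thesis .
qed

end

text \<open>
  The proper case \<open>d \<notin> F\<close>: the stabilizer \<open>H\<close> of \<open>d\<close> is generated by \<open>\<tau> = \<theta>\<^sup>s\<close> with fixed ring \<open>E\<close>, and
  \<open>B.A\<close> is the algebra \<open>K[t;\<tau>]/K[t;\<tau>](t\<^sup>r - d)\<close>.
\<close>

locale proper_cyclic = nonassociative_cyclic K F \<theta> n d for K (structure) and F \<theta> n d +
  fixes s r :: nat
  assumes d_notin: "d \<notin> F"
    and s_pos: "0 < s" and n_eq: "n = s * r" and H_gen: "H = generate G {\<theta> [^]\<^bsub>G\<^esub> s}"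
begin

abbreviation "\<tau> \<equiv> \<theta> [^]\<^bsub>G\<^esub> s"
abbreviation "E \<equiv> {x \<in> carrier K. \<tau> x = x}"

lemma r_pos: "0 < r"
  using n_pos n_eq by simp

lemma fixes_iff: "(\<theta> ^^ c) d = d \<longleftrightarrow> s dvd c"
  using pow_fixes_iff[OF s_pos _ H_gen] n_eq by simp

lemma theta_d: "\<theta> d \<noteq> d"
  using d_notin fixed_iff[OF d_in] by simp

lemma s_ne_1: "s \<noteq> 1"
  using fixes_iff[of 1] theta_d by auto

lemma tau_G: "\<tau> \<in> carrier G"
  using theta_G by simp

lemma tau_apply: "x \<in> carrier K \<Longrightarrow> \<tau> x = (\<theta> ^^ s) x"
  by (rule pow_apply)

lemma tau_pow: "x \<in> carrier K \<Longrightarrow> (\<tau> ^^ i) x = (\<theta> ^^ (s * i)) x"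
  by (induct i) (simp_all add: tau_apply funpow_add)

lemma tau_d: "\<tau> d = d"
  using tau_apply[OF d_in] fixes_iff[of s] by simp

sublocale B: cyclic_petit K \<tau> r d
proof
  show "\<tau> \<in> ring_hom K K" using tau_G by (simp add: mem_aut_group)
  show "(\<tau> ^^ r) x = x" if "x \<in> carrier K" for x
    using tau_pow[OF that, of r] period[OF that] n_eq by simp
qed (use r_pos d_in one_neq_zero in auto)

lemma field_cancel:
  "field K \<Longrightarrow> z \<in> carrier K \<Longrightarrow> x \<in> carrier K \<Longrightarrow> y \<in> carrier K \<Longrightarrow> z \<otimes> x = z \<otimes> y \<Longrightarrow>
    z = \<zero> \<or> x = y"
  using domain.m_lcancel[OF field.axioms(1), of K z x y] by auto

lemma nuc_r_support: "nuc_r A = {z \<in> carrier A. \<forall>c<n. \<not> s dvd c \<longrightarrow> z c = \<zero>}"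
proof -
  have "z \<otimes> d = z \<otimes> (\<theta> ^^ c) d \<longleftrightarrow> (\<not> s dvd c \<longrightarrow> z = \<zero>)" if z: "z \<in> carrier K" and c: "c < n" for z c
  proof
    assume eq: "z \<otimes> d = z \<otimes> (\<theta> ^^ c) d"
    show "\<not> s dvd c \<longrightarrow> z = \<zero>"
    proof
      assume nd: "\<not> s dvd c"
      then have ne: "(\<theta> ^^ c) d \<noteq> d" using fixes_iff by simp
      from field_or_swap show "z = \<zero>"
      proof
        assume "field K"
        then show ?thesis using field_cancel[of z d "(\<theta> ^^ c) d"] eq z d_in ne by auto
      next
        assume sw: "n = 2 \<and> (\<forall>z\<in>carrier K. \<forall>x\<in>carrier K. z \<otimes> x = z \<otimes> \<theta> x \<longrightarrow> z = \<zero> \<or> \<theta> x = x)"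
        then have "c = 1" using c nd by (cases c) auto
        then show ?thesis using sw z d_in eq theta_d by auto
      qed
    qed
  next
    assume "\<not> s dvd c \<longrightarrow> z = \<zero>"
    then show "z \<otimes> d = z \<otimes> (\<theta> ^^ c) d" using fixes_iff[of c] d_in by auto
  qed
  then show ?thesis unfolding nuc_r_eq by (auto simp: alg_closed)
qed

lemma nuc_r_iso: "subst_pow K s \<in> ring_iso B.A (A\<lparr>carrier := nuc_r A\<rparr>)"
  by (rule subst_pow_iso[OF n_eq s_pos B.cyclic_petit_axioms tau_apply nuc_r_support])

lemma center_B: "alg_center B.A = const_poly K ` E"
proof (rule B.center_eq[OF tau_d])
  fix c z assume c: "0 < c" "c < r" and z: "z \<in> carrier K"
    and comm: "\<And>y. y \<in> carrier K \<Longrightarrow> y \<otimes> z = z \<otimes> (\<tau> ^^ c) y"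
  have sc: "0 < s * c" "s * c < n" using c s_pos n_eq by simp_all
  then have "\<not> n dvd s * c" by (auto dest: dvd_imp_le)
  then obtain y where y: "y \<in> carrier K" "(\<theta> ^^ (s * c)) y \<noteq> y"
    using pow_id_iff by blast
  from field_or_swap show "z = \<zero>"
  proof
    assume "field K"
    moreover have "z \<otimes> y = z \<otimes> (\<theta> ^^ (s * c)) y"
      using comm[OF y(1)] z y(1) tau_pow[OF y(1)] by (simp add: m_comm)
    ultimately show ?thesis using field_cancel[of z y "(\<theta> ^^ (s * c)) y"] z y by auto
  next
    assume "n = 2 \<and> (\<forall>z\<in>carrier K. \<forall>x\<in>carrier K. z \<otimes> x = z \<otimes> \<theta> x \<longrightarrow> z = \<zero> \<or> \<theta> x = x)"
    then have "s * c = 1" using sc by linarith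
    then show ?thesis using s_ne_1 by simp
  qed
qed

lemma const_nuc: "const_poly K ` carrier K \<subseteq> nuc A"
  using const_in_nuc by auto

lemma nuc_r_prime:
  assumes "Factorial_Ring.prime n"
  shows "nuc_r A = const_poly K ` carrier K"
proof
  have sn: "s = n" using assms n_eq s_ne_1 by (metis dvd_triv_left prime_nat_iff)
  have "z c = \<zero>" if "z \<in> nuc_r A" "0 < c" "c < n" for z c
  proof -
    have "\<not> s dvd c" using sn that by (auto dest: dvd_imp_le)
    then show ?thesis using that unfolding nuc_r_support by blast
  qed
  then show "nuc_r A \<subseteq> const_poly K ` carrier K"
    by (auto intro!: const_imageI simp: nuc_r_def)
  show "const_poly K ` carrier K \<subseteq> nuc_r A"
    using const_nuc by (auto simp: nuc_def)
qed

lemma nuc_field: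
  assumes "field K"
  shows "nuc A = const_poly K ` carrier K"
proof
  have "x a = \<zero>" if "x \<in> nuc A" "0 < a" "a < n" for x a
  proof -
    have x: "x \<in> nuc_l A" "x \<in> carrier A" using that by (auto simp: nuc_def nuc_l_def)
    then have "x a \<otimes> d = x a \<otimes> \<theta> d" using nuc_l_coeff that by blast
    then show ?thesis
      using field_cancel[OF assms, of "x a" d "\<theta> d"] x d_in theta_d rho_pow_closed[OF d_in, of 1] by auto
  qed
  then show "nuc A \<subseteq> const_poly K ` carrier K"
    by (auto intro!: const_imageI simp: nuc_def nuc_l_def)
qed (rule const_nuc)

lemma degrees:
  assumes "field K"
  shows "subfield E K" "dimension r E (carrier K)" "dimension s F E"
proof -
  have F: "F = {x \<in> carrier K. \<theta> x = x}" using fixed_iff F_sub by auto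
  have E: "E = {x \<in> carrier K. (\<theta> ^^ s) x = x}" using tau_apply by auto
  note tower = field.cyclic_tower[OF assms theta_hom n_eq s_pos r_pos period F E dim_K]
  show "subfield E K" "dimension r E (carrier K)" "dimension s F E" by (rule tower; assumption)+
qed

lemma F_sub_E: "F \<subseteq> E"
  using tau_G F_sub by (auto simp: mem_aut_group)

lemma aut_group_E:
  shows "\<tau> \<in> carrier (aut_group E K)"
    and "generate (aut_group E K) {\<tau>} = carrier (aut_group E K)"
proof -
  have Esub: "E \<subseteq> carrier K" by blast
  show tE: "\<tau> \<in> carrier (aut_group E K)"
    using tau_G by (auto simp: mem_aut_group)
  interpret Bij: group "BijGroup (carrier K)" by (rule group_BijGroup)
  have gen: "generate (aut_group L K) {\<tau>} = generate (BijGroup (carrier K)) {\<tau>}"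
    if "L \<subseteq> carrier K" "\<tau> \<in> carrier (aut_group L K)" for L
    using Bij.generate_consistent[OF _ aut_group_subgroup[OF ring_axioms that(1)], of "{\<tau>}"] that(2)
    by (simp add: aut_group_def)
  interpret GE: group "aut_group E K" by (rule aut_group_group[OF ring_axioms Esub])
  show "generate (aut_group E K) {\<tau>} = carrier (aut_group E K)"
  proof
    show "generate (aut_group E K) {\<tau>} \<subseteq> carrier (aut_group E K)"
      using GE.generate_incl[of "{\<tau>}"] tE by simp
    show "carrier (aut_group E K) \<subseteq> generate (aut_group E K) {\<tau>}"
    proof
      fix \<alpha> assume a: "\<alpha> \<in> carrier (aut_group E K)"
      have "d \<in> E" using d_in tau_d by simp
      then have "\<alpha> \<in> H" using a F_sub_E by (auto simp: mem_aut_group)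
      then show "\<alpha> \<in> generate (aut_group E K) {\<tau>}"
        unfolding H_gen gen[OF F_sub tau_G] gen[OF Esub tE] .
    qed
  qed
qed

lemma assoc_cyclic:
  assumes "field K"
  shows "assoc_cyclic_algebra E K \<tau> r d"
proof -
  note deg = degrees[OF assms]
  have "{x \<in> carrier K. \<forall>\<alpha>\<in>carrier (aut_group E K). \<alpha> x = x} = E"
    using aut_group_E(1) by (auto simp: mem_aut_group)
  then have "galois_field_extension E K"
    using assms deg finite_dimensionI by (auto simp: galois_field_extension_def)
  moreover have "d \<noteq> \<zero>"
    using d_notin subringE(2)[OF subfieldE(1)[OF F_subfield]] by auto
  moreover have "ring B.A"
    by (rule B.ring_if_associative[OF B.associative_if_fixed[OF tau_d]])
  moreover have "ring.dimension B.A (r\<^sup>2) (const_poly K ` E) (carrier B.A)"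
    using B.dimension_over_const_subfield[OF assms tau_d deg(1,2)] by (simp add: power2_eq_square)
  ultimately show ?thesis
    using aut_group_E deg d_in tau_d by (simp add: assoc_cyclic_algebra_def)
qed

end

section \<open>The right nucleus of a proper nonassociative cyclic algebra\<close>

theorem theorem1:
  fixes K :: "('a, 'm) ring_scheme" and F :: "'a set" and \<sigma> :: "'a \<Rightarrow> 'a" and n :: nat and d :: 'a
  defines "G \<equiv> aut_group F K"
  defines "A \<equiv> cyclic_alg K \<sigma> n d"
  defines "H \<equiv> {\<tau> \<in> carrier G. \<tau> d = d}"
  assumes galois: "galois_cyclic_algebra F K n \<sigma>"
    and full_group: "carrier G = generate G {\<sigma>}"
    and unit: "d \<in> Units K"
  shows "(\<not> associative_alg A \<longleftrightarrow> d \<in> carrier K - F) \<and>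
    (\<not> associative_alg A \<longrightarrow>
      (\<exists>s r. 0 < s \<and> n = s * r \<and> H = generate G {\<sigma> [^]\<^bsub>G\<^esub> s}) \<and>
      (\<forall>s r E. 0 < s \<and> n = s * r \<and> H = generate G {\<sigma> [^]\<^bsub>G\<^esub> s} \<and>
          E = {x \<in> carrier K. (\<sigma> [^]\<^bsub>G\<^esub> s) x = x} \<longrightarrow>
        (subst_pow K s \<in> ring_iso (cyclic_alg K (\<sigma> [^]\<^bsub>G\<^esub> s) r d) (A\<lparr>carrier := nuc_r A\<rparr>) \<and>
         alg_center (cyclic_alg K (\<sigma> [^]\<^bsub>G\<^esub> s) r d) = const_poly K ` E \<and>
         const_poly K ` carrier K \<subseteq> nuc_r A \<and>
         const_poly K ` carrier K \<subseteq> nuc A \<and>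
         (Factorial_Ring.prime n \<longrightarrow> nuc_r A = const_poly K ` carrier K)) \<and>
        (galois_field_extension F K \<longrightarrow>
         subst_pow K s \<in> ring_iso (cyclic_alg K (\<sigma> [^]\<^bsub>G\<^esub> s) r d) (A\<lparr>carrier := nuc_r A\<rparr>) \<and>
         subfield E K \<and>
         assoc_cyclic_algebra E K (\<sigma> [^]\<^bsub>G\<^esub> s) r d \<and>
         ring.dimension K s F E \<and>
         nuc A = const_poly K ` carrier K)))"
proof -
  interpret cring K
    using galois by (simp add: galois_cyclic_algebra_def etale_algebra_def)
  have dK: "d \<in> carrier K" using unit by (rule Units_closed)
  interpret C: nonassociative_cyclic K F \<sigma> n d
    using galois full_group dK by unfold_locales (simp_all add: G_def)
  show ?thesis
  proof (intro conjI impI allI)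
    show "\<not> associative_alg A \<longleftrightarrow> d \<in> carrier K - F"
      using C.associative_iff dK by (simp add: A_def)
  next
    show "\<exists>s r. 0 < s \<and> n = s * r \<and> H = generate G {\<sigma> [^]\<^bsub>G\<^esub> s}"
    proof -
      obtain s where "0 < s" "s dvd n" "C.H = generate C.G {\<sigma> [^]\<^bsub>C.G\<^esub> s}"
        by (rule C.stabilizer_cyclic)
      then show ?thesis unfolding H_def G_def by (auto elim!: dvdE)
    qed
  next
    fix s r E assume na: "\<not> associative_alg A"
      and hyp: "0 < s \<and> n = s * r \<and> H = generate G {\<sigma> [^]\<^bsub>G\<^esub> s} \<and>
        E = {x \<in> carrier K. (\<sigma> [^]\<^bsub>G\<^esub> s) x = x}"
    interpret P: proper_cyclic K F \<sigma> n d s r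
      using na hyp C.associative_iff by unfold_locales (auto simp: A_def H_def G_def)
    have E: "E = P.E" using hyp by (simp add: G_def)
    have "const_poly K ` carrier K \<subseteq> nuc_r A"
      using P.const_nuc by (auto simp: nuc_def A_def)
    then show
      "subst_pow K s \<in> ring_iso (cyclic_alg K (\<sigma> [^]\<^bsub>G\<^esub> s) r d) (A\<lparr>carrier := nuc_r A\<rparr>)"
      "alg_center (cyclic_alg K (\<sigma> [^]\<^bsub>G\<^esub> s) r d) = const_poly K ` E"
      "const_poly K ` carrier K \<subseteq> nuc_r A"
      "const_poly K ` carrier K \<subseteq> nuc A"
      "Factorial_Ring.prime n \<Longrightarrow> nuc_r A = const_poly K ` carrier K"
      using P.nuc_r_iso P.center_B P.const_nuc P.nuc_r_prime unfolding A_def G_def E by simp_all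
    assume "galois_field_extension F K"
    then have fld: "field K" by (simp add: galois_field_extension_def)
    show
      "subst_pow K s \<in> ring_iso (cyclic_alg K (\<sigma> [^]\<^bsub>G\<^esub> s) r d) (A\<lparr>carrier := nuc_r A\<rparr>)"
      "subfield E K"
      "assoc_cyclic_algebra E K (\<sigma> [^]\<^bsub>G\<^esub> s) r d"
      "ring.dimension K s F E"
      "nuc A = const_poly K ` carrier K"
      using P.nuc_r_iso P.degrees[OF fld] P.assoc_cyclic[OF fld] P.nuc_field[OF fld]
      unfolding A_def G_def E by simp_all
  qed
qed

end
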